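(* Let $F$ be a forest of size $n$. Then $$\sum_{w \in \mathcal{W}(F)} q^{\mathrm{sor}(F,w)} \prod_{v \in \mathrm{Cyc}(F,w)} t_v = \frac{n!}{\prod_{v \in V(F)}h_v} \prod_{v \in V(F)} \left([h_v]-1+t_v\right),$$ $$\sum_{w \in \mathcal{W}_B(F)} q^{\mathrm{sor}_B(F,w)} \prod_{v \in \mathrm{Cyc}_B(F,w)} t_v = \frac{n!}{\prod_{v \in V(F)}h_v} \prod_{v \in V(F)} \left([2h_v]-1+t_v\right).$$
   Context: $F$ is a finite rooted plane forest with vertex set $V(F)=\{v_1,\dots,v_n\}$, $n\ge 1$. It is drawn with roots on top and regarded as the Hasse diagram of the poset $(V(F),<_F)$: $u<_F v$ means that $u\ne v$ and $u$ is a descendant of $v$. The vertices are naturally indexed: $v_i<_F v_j$ implies $i<j$. For a vertex $v$, $h_v=\#\{u: u\le_F v\}$ is the number of vertices of the subtree rooted at $v$. $\mathcal{W}(F)$ is the set of labelings of $F$, i.e. bijections $w:V(F)\to\{1,\dots,n\}$. $\mathcal{W}_B(F)$ is the set of signed labelings, i.e. injective maps $w:V(F)\to\{\pm1,\dots,\pm n\}$ such that $i\in w(V(F))$ implies $-i\notin w(V(F))$. A labeling $w'\in\mathcal{W}(F)$ is natural if $u<_F v$ implies $w'(u)<w'(v)$. Sorting algorithm. For a signed labeling $w$ and a vertex $u$, $w_u$ denotes the signed labeling of the subtree rooted at $u$ induced by $w$: the absolute values of the labels on the subtree are replaced by their ranks in $\{1,\dots,h_u\}$, preserving their relative order, and the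 signs are kept. Starting from $w\in\mathcal{W}_B(F)$ and $\mathrm{sor}_B(F,w)=0$, for $i=n,n-1,\dots,1$ do the following with the current labeling (still called $w$). Let $v$ be the vertex with $|w(v)|=i$ and let $u$ be the largest vertex (with respect to $<_F$) such that $u\ge_F v$ and $|w(u)|\le i$. Add to $\mathrm{sor}_B$ the amount $|w_u(v)|-w_u(u)$ if $w(u)>0$, and $|w_u(v)|-w_u(u)-1$ if $w(u)<0$. Then, if $w(v)>0$, interchange the labels on $u$ and $v$; if $w(v)<0$, first multiply the labels $w(u)$ and $w(v)$ by $-1$ and then interchange them (if $u=v$, this means that the single negative label is replaced by its absolute value). The final value is $\mathrm{sor}_B(F,w)$, and the final labeling, denoted $w'$, is a natural positive labeling of $F$. For $w\in\mathcal{W}(F)$, $\mathrm{sor}(F,w):=\mathrm{sor}_B(F,w)$. Cycles. $B_n$ is the group of signed permutations: bijections $\pi$ of $\{\pm1,\dots,\pm n\}$ with $\pi(-i)=-\pi(i)$. The map $w\circ (w')^{-1}:\{1,\dots,n\}\to\{\pm1,\dots,\pm n\}$ is extended uniquely to an element of $B_n$. Signed permutations decompose into balanced cycles $(a_1,\dots,a_k)$ (simultaneously taking $-a_1$ to $-a_2$, etc.) and unbalanced cycles $(a_1,\dots,a_k,-a_1,\dots,-a_k)$, the $|a_i|$ being distinct. For $\pi\in B_n$, $\mathrm{Cyc}_B(\pi)=\{|m|: m\text{ is a minimal number in absolute value in a balanced cycle of }\pi\}$; for $\pi\in S_n$, $\mathrm{Cyc}(\pi)$ is the set of minimal elements of the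 cycles of $\pi$. For $w\in\mathcal{W}(F)$, $\mathrm{Cyc}(F,w)=\{v: w'(v)\in \mathrm{Cyc}(w\circ (w')^{-1})\}$, and for $w\in\mathcal{W}_B(F)$, $\mathrm{Cyc}_B(F,w)=\{v: w'(v)\in \mathrm{Cyc}_B(w\circ (w')^{-1})\}$, where $w'$ is the labeling obtained by sorting $w$. $[m]=1+q+\cdots+q^{m-1}$; $q$ and $t_v$ ($v\in V(F)$) are commuting indeterminates. *)

theory Defs
  imports
    Complex_Main
    "HOL-Library.FuncSet"
    "HOL-Library.Poly_Mapping"
    "HOL-Combinatorics.Orbits"
begin

section \<open>Rooted plane forests\<close>

text \<open>The lists carry the plane structure: the left-to-right order of the roots and of the
  children of every vertex.\<close>

record 'v plane_forest =
  verts :: "'v set"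
  roots :: "'v list"
  children :: "'v \<Rightarrow> 'v list"

definition child_rel :: "'v plane_forest \<Rightarrow> ('v \<times> 'v) set" where
  "child_rel F = {(u, v). v \<in> verts F \<and> u \<in> set (children F v)}"

definition rooted_plane_forest :: "'v plane_forest \<Rightarrow> bool" where
  "rooted_plane_forest F \<longleftrightarrow>
     finite (verts F) \<and>
     distinct (roots F) \<and> set (roots F) \<subseteq> verts F \<and>
     (\<forall>v\<in>verts F. distinct (children F v) \<and> set (children F v) \<subseteq> verts F) \<and>
     (\<forall>v\<in>set (roots F). \<nexists>p. (v, p) \<in> child_rel F) \<and>
     (\<forall>v\<in>verts F - set (roots F). \<exists>!p. (v, p) \<in> child_rel F) \<and>
     acyclic (child_rel F)"

definition forest_less :: "'v plane_forest \<Rightarrow> 'v \<Rightarrow> 'v \<Rightarrow> bool" where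
  "forest_less F u v \<longleftrightarrow> (u, v) \<in> (child_rel F)\<^sup>+"

definition forest_le :: "'v plane_forest \<Rightarrow> 'v \<Rightarrow> 'v \<Rightarrow> bool" where
  "forest_le F u v \<longleftrightarrow> u = v \<or> forest_less F u v"

definition subtree :: "'v plane_forest \<Rightarrow> 'v \<Rightarrow> 'v set" where
  "subtree F v = {u \<in> verts F. forest_le F u v}"

definition hook :: "'v plane_forest \<Rightarrow> 'v \<Rightarrow> nat" where
  "hook F v = card (subtree F v)"


section \<open>Labelings\<close>

text \<open>Labelings are extensional functions (\<open>undefined\<close> outside the vertex set), so
  that distinct functions are distinct labelings and sums over all labelings are finite.\<close>

definition labelings :: "'v plane_forest \<Rightarrow> ('v \<Rightarrow> int) set" where
  "labelings F = {w \<in> extensional (verts F). bij_betw w (verts F) {1..int (card (verts F))}}"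

definition signed_labelings :: "'v plane_forest \<Rightarrow> ('v \<Rightarrow> int) set" where
  "signed_labelings F =
     {w \<in> verts F \<rightarrow>\<^sub>E ({- int (card (verts F))..int (card (verts F))} - {0}).
        inj_on w (verts F) \<and> (\<forall>i\<in>w ` verts F. - i \<notin> w ` verts F)}"

text \<open>The labeling \<open>w\<^sub>u\<close> induced by \<open>w\<close> on the subtree rooted at \<open>u\<close>: the sign of \<open>w x\<close>
  times the rank of \<open>\<bar>w x\<bar>\<close> among the absolute values of the labels of that subtree.\<close>

definition induced_labeling :: "'v plane_forest \<Rightarrow> ('v \<Rightarrow> int) \<Rightarrow> 'v \<Rightarrow> 'v \<Rightarrow> int" where
  "induced_labeling F w u x = sgn (w x) * int (card {y \<in> subtree F u. \<bar>w y\<bar> \<le> \<bar>w x\<bar>})"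


section \<open>The sorting algorithm\<close>

definition label_vertex :: "'v plane_forest \<Rightarrow> ('v \<Rightarrow> int) \<Rightarrow> nat \<Rightarrow> 'v" where
  "label_vertex F w i = (THE v. v \<in> verts F \<and> \<bar>w v\<bar> = int i)"

definition target_vertex :: "'v plane_forest \<Rightarrow> ('v \<Rightarrow> int) \<Rightarrow> nat \<Rightarrow> 'v" where
  "target_vertex F w i =
     (let C = {u \<in> verts F. forest_le F (label_vertex F w i) u \<and> \<bar>w u\<bar> \<le> int i}
      in THE u. u \<in> C \<and> (\<forall>x\<in>C. forest_le F x u))"

text \<open>One pass of the loop, acting on the current labeling and the statistic accumulated so
  far. If \<open>u = v\<close> and \<open>w v < 0\<close>, both updates assign \<open>- w v\<close> to \<open>v\<close>.\<close>

definition sort_step ::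
  "'v plane_forest \<Rightarrow> nat \<Rightarrow> ('v \<Rightarrow> int) \<times> int \<Rightarrow> ('v \<Rightarrow> int) \<times> int" where
  "sort_step F i = (\<lambda>(w, s).
     let v = label_vertex F w i;
         u = target_vertex F w i;
         wu = induced_labeling F w u
     in (if w v > 0 then w(u := w v, v := w u) else w(u := - w v, v := - w u),
         s + (if w u > 0 then \<bar>wu v\<bar> - wu u else \<bar>wu v\<bar> - wu u - 1)))"

definition sort_result :: "'v plane_forest \<Rightarrow> ('v \<Rightarrow> int) \<Rightarrow> ('v \<Rightarrow> int) \<times> int" where
  "sort_result F w = fold (sort_step F) (rev [1..<Suc (card (verts F))]) (w, 0)"

definition sorted_labeling :: "'v plane_forest \<Rightarrow> ('v \<Rightarrow> int) \<Rightarrow> 'v \<Rightarrow> int" where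
  "sorted_labeling F w = fst (sort_result F w)"

text \<open>Every summand added by the loop is nonnegative on signed labelings, so \<open>nat\<close>
  does not truncate.\<close>

definition sor_B :: "'v plane_forest \<Rightarrow> ('v \<Rightarrow> int) \<Rightarrow> nat" where
  "sor_B F w = nat (snd (sort_result F w))"

definition sor :: "'v plane_forest \<Rightarrow> ('v \<Rightarrow> int) \<Rightarrow> nat" where
  "sor F w = sor_B F w"


section \<open>Cycles\<close>

text \<open>The extension of a map \<open>{1..n} \<rightarrow> {\<plusminus>1, \<dots>, \<plusminus>n}\<close> to a signed permutation (the identity
  away from \<open>{\<plusminus>1, \<dots>, \<plusminus>n}\<close>).\<close>

definition signed_ext :: "nat \<Rightarrow> (int \<Rightarrow> int) \<Rightarrow> int \<Rightarrow> int" where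
  "signed_ext n f m =
     (if m \<in> {1..int n} then f m else if - m \<in> {1..int n} then - f (- m) else m)"

definition sorting_perm :: "'v plane_forest \<Rightarrow> ('v \<Rightarrow> int) \<Rightarrow> int \<Rightarrow> int" where
  "sorting_perm F w =
     signed_ext (card (verts F)) (w \<circ> inv_into (verts F) (sorted_labeling F w))"

text \<open>The cycles of a permutation of \<open>A\<close>, as sets. On \<open>{\<plusminus>1, \<dots>, \<plusminus>n}\<close>, a balanced cycle
  \<open>(a\<^sub>1, \<dots>, a\<^sub>k)\<close>, which stands for the two cycles through \<open>a\<^sub>1\<close> and through \<open>- a\<^sub>1\<close>, contributes
  both; an unbalanced cycle is a single orbit.\<close>

definition cycle_sets :: "int set \<Rightarrow> (int \<Rightarrow> int) \<Rightarrow> int set set" where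
  "cycle_sets A p = orbit p ` A"

definition balanced :: "int set \<Rightarrow> bool" where
  "balanced C \<longleftrightarrow> inj_on abs C"

definition Cyc_perm :: "nat \<Rightarrow> (int \<Rightarrow> int) \<Rightarrow> int set" where
  "Cyc_perm n p = {m. \<exists>C\<in>cycle_sets {1..int n} p. m \<in> C \<and> (\<forall>a\<in>C. m \<le> a)}"

definition Cyc_B_perm :: "nat \<Rightarrow> (int \<Rightarrow> int) \<Rightarrow> int set" where
  "Cyc_B_perm n p =
     {\<bar>m\<bar> |m. \<exists>C\<in>cycle_sets ({- int n..int n} - {0}) p.
        balanced C \<and> m \<in> C \<and> (\<forall>a\<in>C. \<bar>m\<bar> \<le> \<bar>a\<bar>)}"

definition Cyc :: "'v plane_forest \<Rightarrow> ('v \<Rightarrow> int) \<Rightarrow> 'v set" where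
  "Cyc F w =
     {v \<in> verts F. sorted_labeling F w v \<in> Cyc_perm (card (verts F)) (sorting_perm F w)}"

definition Cyc_B :: "'v plane_forest \<Rightarrow> ('v \<Rightarrow> int) \<Rightarrow> 'v set" where
  "Cyc_B F w =
     {v \<in> verts F. sorted_labeling F w v \<in> Cyc_B_perm (card (verts F)) (sorting_perm F w)}"


section \<open>Polynomials in \<open>q\<close> and the \<open>t\<^sub>v\<close>\<close>

datatype 'v indet = Indet_q | Indet_t 'v

text \<open>Polynomials over the rationals, as finitely supported maps from monomials (finitely
  supported exponent vectors) to coefficients.\<close>

type_synonym 'v qt_poly = "('v indet \<Rightarrow>\<^sub>0 nat) \<Rightarrow>\<^sub>0 rat"

definition indet :: "'v indet \<Rightarrow> 'v qt_poly" where
  "indet x = Poly_Mapping.single (Poly_Mapping.single x 1) 1"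

definition const_poly :: "rat \<Rightarrow> 'v qt_poly" where
  "const_poly c = Poly_Mapping.single 0 c"

definition q_var :: "'v qt_poly" where
  "q_var = indet Indet_q"

definition t_var :: "'v \<Rightarrow> 'v qt_poly" where
  "t_var v = indet (Indet_t v)"

definition q_int :: "nat \<Rightarrow> 'v qt_poly" where
  "q_int m = (\<Sum>i<m. q_var ^ i)"

end

theory Submission
  imports Defs "HOL-Combinatorics.Permutations"
begin

text \<open>
  Run the algorithm backwards. The pass for the label \<open>i\<close> takes a labeling whose labels above \<open>i\<close>
  already form a positive, increasing pattern to one whose labels above \<open>i - 1\<close> do. If the pass
  ends with \<open>i\<close> at the vertex \<open>u\<close>, then every label in the subtree of \<open>u\<close> was at most \<open>i\<close> in
  absolute value, and the pass is undone by choosing the vertex \<open>v\<close> of that subtree, and the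
  sign, from which \<open>i\<close> came. Every choice is possible, so a labeling is the same thing as a natural
  labeling together with one independent choice for each vertex: \<open>h\<^sub>u\<close> choices without signs and
  \<open>2 h\<^sub>u\<close> with them.

  The cost of a pass depends only on the signed rank, in the subtree of \<open>u\<close>, of the label that \<open>u\<close>
  held before, and this signed rank runs through all possible values as the choice varies. The
  costs of the choices at \<open>u\<close> are thus \<open>0, 1, \<dots>, h\<^sub>u - 1\<close>, respectively \<open>0, 1, \<dots>, 2 h\<^sub>u - 1\<close>, each
  taken once (\<open>cost_bij\<close>); cost \<open>0\<close> means that the pass does nothing.

  Undoing the pass changes the permutation \<open>w \<circ> w'\<^sup>-\<^sup>1\<close> as follows. A choice with \<open>v \<noteq> u\<close> inserts
  \<open>\<plusminus>i\<close> into the cycle of a smaller number and does not affect balance or minima; the choice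
  \<open>v = u\<close> with positive sign makes \<open>i\<close> a fixed point; the choice \<open>v = u\<close> with negative sign creates
  the unbalanced cycle \<open>(i, -i)\<close>. Hence \<open>u\<close> is counted by the cycle statistic exactly if its pass
  costs \<open>0\<close> (\<open>balanced_min_new\<close>, \<open>balanced_min_old\<close>). The vertex \<open>u\<close> therefore contributes the
  factor \<open>t\<^sub>u + q + q\<^sup>2 + \<dots>\<close>, whatever the natural labeling is, and the sum over all labelings is
  the number of natural labelings times the product of these factors (\<open>sum_statistics\<close>).
  Setting all variables to \<open>1\<close> in the unsigned case shows that the number of natural labelings is
  \<open>n! / \<Prod> h\<^sub>v\<close> (\<open>hook_length_formula\<close>).
\<close>

section \<open>Minimal elements of balanced cycles\<close>

text \<open>A single condition on the orbit of \<open>m\<close> expresses both that the cycle is balanced and that \<open>m\<close> is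
  its minimum in absolute value: in a cycle of an odd permutation, two distinct elements of the same
  absolute value occur if and only if \<open>- m\<close> occurs along with \<open>m\<close>.\<close>

definition balanced_min :: "(int \<Rightarrow> int) \<Rightarrow> int \<Rightarrow> bool" where
  "balanced_min p m \<longleftrightarrow> (\<forall>a\<in>orbit p m. a = m \<or> m < \<bar>a\<bar>)"

lemma orbit_uminus:
  assumes odd: "\<And>x. p (- x) = - p (x::int)" and "y \<in> orbit p x"
  shows "- y \<in> orbit p (- x)"
  using assms(2)
proof induction
  case base
  have "p (- x) \<in> orbit p (- x)" by (rule orbit.base)
  then show ?case by (simp add: odd)
next
  case (step y)
  then have "p (- y) \<in> orbit p (- x)" by (intro orbit.step)
  then show ?case by (simp add: odd)
qed

lemma Cyc_B_perm_iff:
  assumes perm: "p permutes ({- int n..int n} - {0})"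
    and odd: "\<And>x. p (- x) = - p x"
    and m: "m \<in> {1..int n}"
  shows "m \<in> Cyc_B_perm n p \<longleftrightarrow> balanced_min p m"
proof -
  let ?S = "{- int n..int n} - {0}"
  have fin: "permutation p"
    unfolding permutation_permutes using perm by (intro exI[of _ ?S]) simp
  have self: "x \<in> orbit p x" for x
    using fin by (rule permutation_self_in_orbit)
  have eq: "orbit p y = orbit p x" if "y \<in> orbit p x" for x y
    using cyclic_on_orbit'[OF fin] that by (rule orbit_cyclic_eq3)
  have neg: "- y \<in> orbit p (- x)" if "y \<in> orbit p x" for x y
    using orbit_uminus[OF odd that] .
  show ?thesis
  proof
    assume "m \<in> Cyc_B_perm n p"
    then obtain m' x where m': "m = \<bar>m'\<bar>" "balanced (orbit p x)" "m' \<in> orbit p x"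
      "\<forall>a\<in>orbit p x. \<bar>m'\<bar> \<le> \<bar>a\<bar>"
      unfolding Cyc_B_perm_def cycle_sets_def by blast
    have o: "orbit p x = orbit p m'" using eq m'(3) by auto
    have key: "a = m' \<or> m < \<bar>a\<bar>" if "a \<in> orbit p m'" for a
    proof (cases "\<bar>a\<bar> = \<bar>m'\<bar>")
      case True
      then have "a = m'"
        using m'(2,3) that unfolding balanced_def o by (auto dest: inj_onD)
      then show ?thesis ..
    next
      case False
      have "\<bar>m'\<bar> \<le> \<bar>a\<bar>" using m'(4) that unfolding o by blast
      then show ?thesis using False m'(1) by linarith
    qed
    show "balanced_min p m"
    proof (cases "m' = m")
      case True
      then show ?thesis using key by (auto simp: balanced_min_def)
    next
      case False
      then have mm: "m' = - m" using m'(1) by linarith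
      show ?thesis unfolding balanced_min_def
      proof
        fix a assume "a \<in> orbit p m"
        then have "- a \<in> orbit p m'" using neg mm by blast
        then have "- a = m' \<or> m < \<bar>- a\<bar>" by (rule key)
        then show "a = m \<or> m < \<bar>a\<bar>" using mm by auto
      qed
    qed
  next
    assume good: "balanced_min p m"
    have "balanced (orbit p m)"
      unfolding balanced_def inj_on_def
    proof (intro ballI impI, rule ccontr)
      fix a b assume ab: "a \<in> orbit p m" "b \<in> orbit p m" "\<bar>a\<bar> = \<bar>b\<bar>" "a \<noteq> b"
      then have b: "b = - a" by linarith
      have "m \<in> orbit p a" using eq[OF ab(1)] self by auto
      then have "- m \<in> orbit p (- a)" by (rule neg)
      then have "- m \<in> orbit p m" using eq[OF ab(2)] b by auto
      then show False using good m by (auto simp: balanced_min_def)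
    qed
    moreover have "\<forall>a\<in>orbit p m. \<bar>m\<bar> \<le> \<bar>a\<bar>"
      using good m by (auto simp: balanced_min_def)
    moreover have "m \<in> ?S" using m by auto
    ultimately have "\<exists>C\<in>cycle_sets ?S p. balanced C \<and> m \<in> C \<and> (\<forall>a\<in>C. \<bar>m\<bar> \<le> \<bar>a\<bar>)"
      unfolding cycle_sets_def using self[of m] by blast
    then show "m \<in> Cyc_B_perm n p"
      unfolding Cyc_B_perm_def using m by (auto intro!: exI[of _ m])
  qed
qed

text \<open>On a permutation that preserves positivity, every cycle through a positive number is balanced,
  so the unsigned cycle statistic is a case of the signed one.\<close>

lemma Cyc_perm_iff:
  assumes perm: "permutation p" and pos: "p ` {1..int n} \<subseteq> {1..int n}"
    and m: "m \<in> {1..int n}"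
  shows "m \<in> Cyc_perm n p \<longleftrightarrow> balanced_min p m"
proof -
  have self: "x \<in> orbit p x" for x
    using perm by (rule permutation_self_in_orbit)
  have eq: "orbit p y = orbit p x" if "y \<in> orbit p x" for x y
    using cyclic_on_orbit'[OF perm] that by (rule orbit_cyclic_eq3)
  have range: "a \<in> {1..int n}" if "a \<in> orbit p m" for a
    using that
  proof induction
    case base
    show ?case using m pos by blast
  next
    case (step y)
    then show ?case using pos by blast
  qed
  have "m \<in> Cyc_perm n p \<longleftrightarrow> (\<forall>a\<in>orbit p m. m \<le> a)"
  proof
    assume "m \<in> Cyc_perm n p"
    then obtain x where "m \<in> orbit p x" "\<forall>a\<in>orbit p x. m \<le> a"
      unfolding Cyc_perm_def cycle_sets_def by blast
    then show "\<forall>a\<in>orbit p m. m \<le> a" using eq by auto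
  next
    assume "\<forall>a\<in>orbit p m. m \<le> a"
    then show "m \<in> Cyc_perm n p"
      unfolding Cyc_perm_def cycle_sets_def using m self[of m] by blast
  qed
  also have "\<dots> \<longleftrightarrow> balanced_min p m"
    unfolding balanced_min_def
  proof (intro ball_cong refl)
    fix a assume "a \<in> orbit p m"
    then have "1 \<le> a" using range by auto
    then show "m \<le> a \<longleftrightarrow> a = m \<or> m < \<bar>a\<bar>" by auto
  qed
  finally show ?thesis .
qed

text \<open>If \<open>p\<close> arises from \<open>p'\<close> by inserting numbers of absolute value \<open>i\<close> into cycles of smaller numbers,
  then following \<open>p\<close> and skipping the inserted numbers is the same as following \<open>p'\<close>.\<close>

lemma orbit_bypass:
  fixes i :: int
  assumes inner: "\<And>y. \<bar>y\<bar> < i \<Longrightarrow> \<bar>p' y\<bar> < i"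
    and detour: "\<And>y. \<bar>y\<bar> < i \<Longrightarrow> p y = p' y \<or> \<bar>p y\<bar> = i \<and> p (p y) = p' y"
    and m: "\<bar>m\<bar> < i"
  shows "orbit p' m \<subseteq> orbit p m"
    and "\<And>y. y \<in> orbit p m \<Longrightarrow> y \<in> orbit p' m \<or> \<bar>y\<bar> = i"
proof -
  have small: "\<bar>y\<bar> < i" if "y \<in> orbit p' m" for y
    using that by induction (use inner m in auto)
  have advance: "p' y \<in> orbit p m" if "\<bar>y\<bar> < i" "p y \<in> orbit p m" for y
    using detour[OF that(1)] that(2) by (metis orbit.step)
  show "orbit p' m \<subseteq> orbit p m"
  proof
    fix y assume "y \<in> orbit p' m"
    then show "y \<in> orbit p m"
    proof induction
      case base
      show ?case by (rule advance[OF m orbit.base])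
    next
      case (step y)
      show ?case by (rule advance[OF small[OF step.hyps] orbit.step[OF step.IH]])
    qed
  qed
  show "y \<in> orbit p' m \<or> \<bar>y\<bar> = i" if "y \<in> orbit p m" for y
  proof -
    \<comment> \<open>At an inserted number, the induction has to remember where the detour returns.\<close>
    have "y \<in> orbit p' m \<or> \<bar>y\<bar> = i \<and> p y \<in> orbit p' m"
      using that
    proof induction
      case base
      show ?case using detour[OF m] orbit.base[of p' m] by auto
    next
      case (step y)
      from step.IH show ?case
      proof
        assume y: "y \<in> orbit p' m"
        then show ?thesis using detour[OF small[OF y]] orbit.step[OF y] by auto
      qed auto
    qed
    then show ?thesis by auto
  qed
qed

lemma balanced_min_bypass:
  fixes i :: int
  assumes inner: "\<And>y. \<bar>y\<bar> < i \<Longrightarrow> \<bar>p' y\<bar> < i"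
    and detour: "\<And>y. \<bar>y\<bar> < i \<Longrightarrow> p y = p' y \<or> \<bar>p y\<bar> = i \<and> p (p y) = p' y"
    and m: "\<bar>m\<bar> < i"
  shows "balanced_min p m \<longleftrightarrow> balanced_min p' m"
proof -
  have sub: "orbit p' m \<subseteq> orbit p m" and ext: "y \<in> orbit p m \<Longrightarrow> y \<in> orbit p' m \<or> \<bar>y\<bar> = i" for y
    using orbit_bypass[of i p' p m] assms by blast+
  show ?thesis
    unfolding balanced_min_def
  proof (intro iffI ballI)
    fix a assume "\<forall>a\<in>orbit p m. a = m \<or> m < \<bar>a\<bar>" "a \<in> orbit p' m"
    then show "a = m \<or> m < \<bar>a\<bar>" using sub by blast
  next
    fix a assume "\<forall>a\<in>orbit p' m. a = m \<or> m < \<bar>a\<bar>" "a \<in> orbit p m"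
    then show "a = m \<or> m < \<bar>a\<bar>" using ext[of a] m by fastforce
  qed
qed


section \<open>The order of a rooted forest\<close>

locale rooted_forest =
  fixes F :: "'v plane_forest"
  assumes rooted: "rooted_plane_forest F"
begin

abbreviation V :: "'v set" where "V \<equiv> verts F"
abbreviation size_F :: nat ("n") where "n \<equiv> card (verts F)"
abbreviation below (infix "\<preceq>" 50) where "x \<preceq> y \<equiv> forest_le F x y"
abbreviation strictly_below (infix "\<prec>" 50) where "x \<prec> y \<equiv> forest_less F x y"

lemma finite_V [simp]: "finite V"
  using rooted by (simp add: rooted_plane_forest_def)

lemma child_rel_subset: "child_rel F \<subseteq> V \<times> V"
  using rooted by (auto simp: rooted_plane_forest_def child_rel_def)

lemma single_valued_child_rel: "single_valued (child_rel F)"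
proof (rule single_valuedI)
  fix x y z assume xy: "(x, y) \<in> child_rel F" "(x, z) \<in> child_rel F"
  then have "x \<in> V" using child_rel_subset by auto
  moreover have "x \<notin> set (roots F)"
    using xy rooted by (auto simp: rooted_plane_forest_def)
  ultimately have "\<exists>!p. (x, p) \<in> child_rel F"
    using rooted by (simp add: rooted_plane_forest_def)
  then show "y = z" using xy by blast
qed

lemma forest_less_in_V: "x \<prec> y \<Longrightarrow> x \<in> V \<and> y \<in> V"
  unfolding forest_less_def using trancl_subset_Sigma[OF child_rel_subset] by auto

lemma forest_less_irrefl: "\<not> x \<prec> x"
  using rooted by (simp add: rooted_plane_forest_def forest_less_def acyclic_def)

lemma forest_less_trans: "x \<prec> y \<Longrightarrow> y \<prec> z \<Longrightarrow> x \<prec> z"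
  unfolding forest_less_def by (rule trancl_trans)

lemma forest_le_less_trans: "x \<preceq> y \<Longrightarrow> y \<prec> z \<Longrightarrow> x \<prec> z"
  unfolding forest_le_def using forest_less_trans by blast

lemma forest_le_iff_rtrancl: "x \<preceq> y \<longleftrightarrow> (x, y) \<in> (child_rel F)\<^sup>*"
  by (auto simp: forest_le_def forest_less_def rtrancl_eq_or_trancl)

definition natural_labelings :: "('v \<Rightarrow> int) set" where
  "natural_labelings = {b \<in> extensional V. bij_betw b V {1..int n} \<and>
     (\<forall>x y. x \<prec> y \<longrightarrow> b x < b y)}"

text \<open>A vertex has at most one parent, so its ancestors form a chain; this is what makes the target of
  a sorting pass well defined.\<close>

lemma ancestors_comparable:
  assumes "v \<preceq> x" "v \<preceq> y" shows "x \<preceq> y \<or> y \<prec> x"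
  using single_valued_confluent[OF single_valued_child_rel, of v x y] assms
  unfolding forest_le_iff_rtrancl[symmetric] by (auto simp: forest_le_def)

lemma exists_top:
  assumes "v \<in> C" "C \<subseteq> V"
  obtains u where "u \<in> C" "\<And>x. u \<prec> x \<Longrightarrow> x \<notin> C"
proof -
  have "wf ((child_rel F)\<inverse>)"
  proof (rule finite_acyclic_wf_converse)
    show "finite (child_rel F)"
      using child_rel_subset by (rule finite_subset) simp
    show "acyclic (child_rel F)"
      using rooted by (simp add: rooted_plane_forest_def)
  qed
  then have "wf (((child_rel F)\<^sup>+)\<inverse>)"
    by (metis trancl_converse wf_trancl)
  then obtain u where "u \<in> C" "\<And>x. (x, u) \<in> ((child_rel F)\<^sup>+)\<inverse> \<Longrightarrow> x \<notin> C"
    using wfE_min[of "((child_rel F)\<^sup>+)\<inverse>" v C] assms by metis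
  then show ?thesis using that unfolding forest_less_def by auto
qed

lemma finite_subtree [simp]: "finite (subtree F u)"
  by (simp add: subtree_def)

lemma subtree_refl: "u \<in> V \<Longrightarrow> u \<in> subtree F u"
  by (simp add: subtree_def forest_le_def)

lemma hook_pos: "u \<in> V \<Longrightarrow> 0 < hook F u"
  using subtree_refl[of u] by (auto simp: hook_def card_gt_0_iff)

text \<open>The ancestors of the current vertex with small labels have a greatest element as soon as they
  have a maximal one, because they are comparable.\<close>

lemma target_vertexI:
  assumes v: "label_vertex F w i = v" and u: "u \<in> V" "v \<preceq> u" "\<bar>w u\<bar> \<le> int i"
    and top: "\<And>x. u \<prec> x \<Longrightarrow> int i < \<bar>w x\<bar>"
  shows "target_vertex F w i = u"
  unfolding target_vertex_def Let_def v
proof (rule the_equality)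
  show "u \<in> {u \<in> V. v \<preceq> u \<and> \<bar>w u\<bar> \<le> int i} \<and> (\<forall>x\<in>{u \<in> V. v \<preceq> u \<and> \<bar>w u\<bar> \<le> int i}. x \<preceq> u)"
  proof (intro conjI ballI)
    fix x assume x: "x \<in> {u \<in> V. v \<preceq> u \<and> \<bar>w u\<bar> \<le> int i}"
    then have "\<not> u \<prec> x" using top[of x] by auto
    then show "x \<preceq> u" using ancestors_comparable[of v x u] x u by auto
  qed (use u in auto)
  fix z
  assume z: "z \<in> {u \<in> V. v \<preceq> u \<and> \<bar>w u\<bar> \<le> int i} \<and> (\<forall>x\<in>{u \<in> V. v \<preceq> u \<and> \<bar>w u\<bar> \<le> int i}. x \<preceq> z)"
  then have "u \<preceq> z" using u by blast
  then show "z = u" using z top[of z] by (auto simp: forest_le_def)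
qed

end


section \<open>Sorting passes as signed transpositions\<close>

definition sort_move :: "'v plane_forest \<Rightarrow> nat \<Rightarrow> ('v \<Rightarrow> int) \<Rightarrow> 'v \<Rightarrow> int" where
  "sort_move F i w = fst (sort_step F i (w, 0))"

definition sort_cost :: "'v plane_forest \<Rightarrow> nat \<Rightarrow> ('v \<Rightarrow> int) \<Rightarrow> int" where
  "sort_cost F i w = snd (sort_step F i (w, 0))"

lemma sort_step_eq: "sort_step F i (w, s) = (sort_move F i w, s + sort_cost F i w)"
  by (simp add: sort_move_def sort_cost_def sort_step_def Let_def)

primrec sort_down :: "'v plane_forest \<Rightarrow> nat \<Rightarrow> ('v \<Rightarrow> int) \<Rightarrow> 'v \<Rightarrow> int" where
  "sort_down F 0 w = w"
| "sort_down F (Suc k) w = sort_down F k (sort_move F (Suc k) w)"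

primrec total_cost :: "'v plane_forest \<Rightarrow> nat \<Rightarrow> ('v \<Rightarrow> int) \<Rightarrow> int" where
  "total_cost F 0 w = 0"
| "total_cost F (Suc k) w = sort_cost F (Suc k) w + total_cost F k (sort_move F (Suc k) w)"

lemma fold_sort_step:
  "fold (sort_step F) (rev [1..<Suc k]) (w, s) = (sort_down F k w, s + total_cost F k w)"
proof (induction k arbitrary: w s)
  case (Suc k)
  have "rev [1..<Suc (Suc k)] = Suc k # rev [1..<Suc k]" by simp
  then have "fold (sort_step F) (rev [1..<Suc (Suc k)]) (w, s) =
      fold (sort_step F) (rev [1..<Suc k]) (sort_move F (Suc k) w, s + sort_cost F (Suc k) w)"
    by (simp only: fold_Cons o_apply sort_step_eq)
  then show ?case by (simp only: Suc.IH sort_down.simps total_cost.simps add.assoc)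
qed simp

text \<open>Both cases of a sorting pass, and also the inverse of a pass, have this form, with \<open>e\<close> the sign of
  the label that is sorted; for \<open>u = v\<close> the label of \<open>u\<close> is multiplied by \<open>e\<close>.\<close>

definition twist :: "int \<Rightarrow> 'v \<Rightarrow> 'v \<Rightarrow> ('v \<Rightarrow> int) \<Rightarrow> 'v \<Rightarrow> int" where
  "twist e u v w = w(u := e * w v, v := e * w u)"

lemma abs_twist: "\<bar>e\<bar> = 1 \<Longrightarrow> \<bar>twist e u v w x\<bar> = \<bar>w (transpose u v x)\<bar>"
  by (auto simp: twist_def abs_mult transpose_def)

lemma twist_twist: "\<bar>e\<bar> = 1 \<Longrightarrow> twist e u v (twist e u v w) = w"
  by (auto simp: twist_def fun_eq_iff abs_if split: if_splits)

text \<open>The twist permutes the absolute values of the labels inside the subtree, so ranks move along with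
  the labels. The cost of a pass can thus be read off from the labeling after the pass.\<close>

lemma induced_labeling_twist:
  assumes e: "\<bar>e\<bar> = 1" and uv: "u \<in> subtree F u" "v \<in> subtree F u"
  shows "induced_labeling F (twist e u v w) u v = e * induced_labeling F w u u"
proof -
  have "bij_betw (transpose u v) {y \<in> subtree F u. \<bar>twist e u v w y\<bar> \<le> \<bar>w u\<bar>}
      {y \<in> subtree F u. \<bar>w y\<bar> \<le> \<bar>w u\<bar>}"
  proof (rule bij_betw_byWitness[where f' = "transpose u v"])
    have "transpose u v y \<in> subtree F u" if "y \<in> subtree F u" for y
      using uv that by (simp add: transpose_def)
    then show "transpose u v ` {y \<in> subtree F u. \<bar>twist e u v w y\<bar> \<le> \<bar>w u\<bar>}
        \<subseteq> {y \<in> subtree F u. \<bar>w y\<bar> \<le> \<bar>w u\<bar>}"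
      and "transpose u v ` {y \<in> subtree F u. \<bar>w y\<bar> \<le> \<bar>w u\<bar>}
        \<subseteq> {y \<in> subtree F u. \<bar>twist e u v w y\<bar> \<le> \<bar>w u\<bar>}"
      by (auto simp: abs_twist[OF e])
  qed simp_all
  then have "card {y \<in> subtree F u. \<bar>twist e u v w y\<bar> \<le> \<bar>w u\<bar>} =
      card {y \<in> subtree F u. \<bar>w y\<bar> \<le> \<bar>w u\<bar>}"
    by (rule bij_betw_same_card)
  moreover have "twist e u v w v = e * w u" by (simp add: twist_def)
  moreover have "sgn e = e" using e by (auto simp: abs_if split: if_splits)
  ultimately show ?thesis
    by (simp add: induced_labeling_def sgn_mult abs_mult e)
qed

text \<open>The cost of a pass as a function of the size \<open>h\<close> of the subtree of its target and of the signed
  rank \<open>s\<close> of the label at the target: it enumerates the signed ranks in the order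
  \<open>h, \<dots>, 1, -1, \<dots>, -h\<close>, starting with \<open>0\<close>.\<close>

definition cost_of :: "nat \<Rightarrow> int \<Rightarrow> int" where
  "cost_of h s = (if 0 < s then int h - s else int h - s - 1)"

text \<open>The weight of a run is the product of the weights \<open>f u c\<close> of its passes, where \<open>u\<close> is the target and
  \<open>c\<close> is the cost. Keeping \<open>f\<close> arbitrary allows the sum over all runs to be computed before the cycle
  statistic is considered.\<close>

primrec run_weight ::
  "'v plane_forest \<Rightarrow> ('v \<Rightarrow> nat \<Rightarrow> 'a::comm_semiring_1) \<Rightarrow> nat \<Rightarrow> ('v \<Rightarrow> int) \<Rightarrow> 'a" where
  "run_weight F f 0 w = 1"
| "run_weight F f (Suc k) w =
     f (target_vertex F w (Suc k)) (nat (sort_cost F (Suc k) w)) *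
     run_weight F f k (sort_move F (Suc k) w)"

text \<open>The signed permutation of \<open>w\<close> relative to a reference labeling \<open>b\<close>. During a run the reference is
  the final labeling throughout, so that the permutations of successive labelings can be compared.\<close>

definition label_perm :: "'v plane_forest \<Rightarrow> ('v \<Rightarrow> int) \<Rightarrow> ('v \<Rightarrow> int) \<Rightarrow> int \<Rightarrow> int" where
  "label_perm F w b = signed_ext (card (verts F)) (w \<circ> inv_into (verts F) b)"

lemma label_perm_uminus: "label_perm F w b (- m) = - label_perm F w b m"
  by (auto simp: label_perm_def signed_ext_def)


section \<open>Partially sorted labelings\<close>

text \<open>The set \<open>E\<close> of admissible signs treats unsigned and signed labelings at once. As \<open>E\<close> is closed under
  multiplication, sorting passes and their inverses preserve admissibility.\<close>

locale signed_forest = rooted_forest F for F :: "'v plane_forest" +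
  fixes E :: "int set"
  assumes E_cases: "E = {1} \<or> E = {1, -1}"
begin

text \<open>The labelings that occur in a run after the labels \<open>n, \<dots>, k + 1\<close> have been sorted: for \<open>k = n\<close>
  all labelings, for \<open>k = 0\<close> the natural ones. The condition on \<open>x \<prec> y\<close> forces
  the vertices with labels above \<open>k\<close> to be closed under taking ancestors.\<close>

definition sorted_above :: "nat \<Rightarrow> ('v \<Rightarrow> int) set" where
  "sorted_above k = {w \<in> extensional V. bij_betw (\<lambda>x. \<bar>w x\<bar>) V {1..int n} \<and>
     (\<forall>x\<in>V. sgn (w x) \<in> E) \<and>
     (\<forall>x\<in>V. int k < \<bar>w x\<bar> \<longrightarrow> 0 < w x \<and> (\<forall>y. x \<prec> y \<longrightarrow> w x < w y))}"

lemma E_abs: "e \<in> E \<Longrightarrow> \<bar>e\<bar> = 1"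
  using E_cases by auto

lemma E_sgn: "e \<in> E \<Longrightarrow> sgn e = e"
  using E_cases by auto

lemma E_mult: "e \<in> E \<Longrightarrow> e' \<in> E \<Longrightarrow> e * e' \<in> E"
  using E_cases by auto

lemma finite_E [simp]: "finite E"
  using E_cases by auto

context
  fixes k w assumes w: "w \<in> sorted_above k"
begin

lemma sorted_above_bij: "bij_betw (\<lambda>x. \<bar>w x\<bar>) V {1..int n}"
  and sorted_above_ext: "w \<in> extensional V"
  and sorted_above_sgn: "x \<in> V \<Longrightarrow> sgn (w x) \<in> E"
  and sorted_above_pos: "x \<in> V \<Longrightarrow> int k < \<bar>w x\<bar> \<Longrightarrow> 0 < w x"
  and sorted_above_less: "x \<prec> y \<Longrightarrow> int k < \<bar>w x\<bar> \<Longrightarrow> w x < w y"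
  using w forest_less_in_V by (auto simp: sorted_above_def)

lemma sorted_above_range: "x \<in> V \<Longrightarrow> 1 \<le> \<bar>w x\<bar> \<and> \<bar>w x\<bar> \<le> int n"
  using bij_betwE[OF sorted_above_bij] by auto

lemma sorted_above_inj: "x \<in> V \<Longrightarrow> y \<in> V \<Longrightarrow> \<bar>w x\<bar> = \<bar>w y\<bar> \<Longrightarrow> x = y"
  using sorted_above_bij by (auto simp: bij_betw_def dest: inj_onD)

lemma sorted_above_nonzero: "x \<in> V \<Longrightarrow> w x \<noteq> 0"
  using sorted_above_range[of x] by auto

lemma sorted_above_down:
  assumes "x \<preceq> y" "\<bar>w y\<bar> \<le> int i" "k \<le> i" shows "\<bar>w x\<bar> \<le> int i"
proof (rule ccontr)
  assume x: "\<not> \<bar>w x\<bar> \<le> int i"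
  then have xy: "x \<prec> y" using assms by (auto simp: forest_le_def)
  then have "w x < w y" using sorted_above_less x assms(3) by simp
  moreover have "0 < w x"
    using sorted_above_pos[of x] forest_less_in_V[OF xy] x assms(3) by auto
  ultimately show False using x assms(2) by linarith
qed

lemma label_vertexI: "v \<in> V \<Longrightarrow> \<bar>w v\<bar> = int i \<Longrightarrow> label_vertex F w i = v"
  unfolding label_vertex_def using sorted_above_inj by (intro the_equality) auto

lemma label_vertex_works:
  assumes "1 \<le> i" "i \<le> n"
  shows "label_vertex F w i \<in> V" "\<bar>w (label_vertex F w i)\<bar> = int i"
proof -
  have "int i \<in> (\<lambda>x. \<bar>w x\<bar>) ` V"
    using sorted_above_bij assms by (simp add: bij_betw_def)
  then obtain v where "v \<in> V" "\<bar>w v\<bar> = int i" by auto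
  then show "label_vertex F w i \<in> V" "\<bar>w (label_vertex F w i)\<bar> = int i"
    using label_vertexI by auto
qed

lemma target_vertex_works:
  assumes i: "1 \<le> i" "i \<le> n"
  shows "target_vertex F w i \<in> V" "label_vertex F w i \<preceq> target_vertex F w i"
    "\<bar>w (target_vertex F w i)\<bar> \<le> int i"
    "\<And>x. target_vertex F w i \<prec> x \<Longrightarrow> int i < \<bar>w x\<bar>"
proof -
  define v where "v = label_vertex F w i"
  define C where "C = {u \<in> V. v \<preceq> u \<and> \<bar>w u\<bar> \<le> int i}"
  have v: "v \<in> C"
    using label_vertex_works[OF i] by (simp add: C_def v_def forest_le_def)
  have "C \<subseteq> V" by (auto simp: C_def)
  with v obtain u where u: "u \<in> C" "\<And>x. u \<prec> x \<Longrightarrow> x \<notin> C"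
    by (rule exists_top) blast
  have top: "int i < \<bar>w x\<bar>" if "u \<prec> x" for x
  proof -
    have "v \<preceq> x"
      using u(1) that forest_le_less_trans[of v u x] by (auto simp: C_def forest_le_def)
    then show ?thesis using u(2)[OF that] forest_less_in_V[OF that] by (auto simp: C_def)
  qed
  have "target_vertex F w i = u"
    using u(1) top by (intro target_vertexI[of w i v]) (auto simp: C_def v_def)
  then show "target_vertex F w i \<in> V" "label_vertex F w i \<preceq> target_vertex F w i"
    "\<bar>w (target_vertex F w i)\<bar> \<le> int i"
    "\<And>x. target_vertex F w i \<prec> x \<Longrightarrow> int i < \<bar>w x\<bar>"
    using u(1) top by (auto simp: C_def v_def)
qed

lemma twist_preserves:
  assumes e: "e \<in> E" and uv: "u \<in> V" "v \<in> V"
  shows "twist e u v w \<in> extensional V"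
    "bij_betw (\<lambda>x. \<bar>twist e u v w x\<bar>) V {1..int n}"
    "x \<in> V \<Longrightarrow> sgn (twist e u v w x) \<in> E"
proof -
  show "twist e u v w \<in> extensional V"
    using sorted_above_ext uv by (auto simp: twist_def extensional_def)
  have "bij_betw (transpose u v) V V"
    using uv by (intro permutes_imp_bij permutes_swap_id)
  then show "bij_betw (\<lambda>x. \<bar>twist e u v w x\<bar>) V {1..int n}"
    using bij_betw_trans[OF _ sorted_above_bij, of "transpose u v" V]
    by (simp add: abs_twist[OF E_abs[OF e]] o_def)
  show "x \<in> V \<Longrightarrow> sgn (twist e u v w x) \<in> E"
    using sorted_above_sgn uv e by (auto simp: twist_def sgn_mult E_mult E_sgn)
qed

end


section \<open>A sorting pass and its inverse\<close>

lemma sort_move_eq_twist: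
  assumes w: "w \<in> sorted_above k" and i: "1 \<le> i" "i \<le> n"
  shows "sort_move F i w =
    twist (sgn (w (label_vertex F w i))) (target_vertex F w i) (label_vertex F w i) w"
  using sorted_above_nonzero[OF w label_vertex_works(1)[OF w i]]
  by (auto simp: sort_move_def sort_step_def Let_def twist_def)

context
  fixes k w u v
  assumes k: "Suc k \<le> n" and w: "w \<in> sorted_above (Suc k)"
    and v_def: "v = label_vertex F w (Suc k)" and u_def: "u = target_vertex F w (Suc k)"
begin

lemma move_facts:
  shows "v \<in> V" "u \<in> V" "v \<preceq> u" "\<bar>w v\<bar> = int (Suc k)" "\<bar>w u\<bar> \<le> int (Suc k)"
    "\<And>x. u \<prec> x \<Longrightarrow> int (Suc k) < \<bar>w x\<bar>"
  using label_vertex_works[OF w, of "Suc k"] target_vertex_works[OF w, of "Suc k"] k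
  by (auto simp: v_def u_def)

lemma sgn_in_E: "sgn (w v) \<in> E"
  using sorted_above_sgn[OF w] move_facts(1) .

lemma sort_move_twist: "sort_move F (Suc k) w = twist (sgn (w v)) u v w"
  using sort_move_eq_twist[OF w] k by (simp add: u_def v_def)

lemma move_at_target: "sort_move F (Suc k) w u = int (Suc k)"
  using move_facts(4) by (auto simp: sort_move_twist twist_def sgn_mult_self_eq abs_sgn mult.commute)

text \<open>By maximality of the target \<open>u\<close>, all strict ancestors of \<open>u\<close> carry labels above \<open>Suc k\<close>; placing
  \<open>Suc k\<close> at \<open>u\<close> is therefore compatible with the part that is already sorted.\<close>

lemma sort_move_sorted: "sort_move F (Suc k) w \<in> sorted_above k"
proof -
  let ?w = "sort_move F (Suc k) w"
  note tw = sort_move_twist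
  have same: "?w x = w x" if "x \<noteq> u" "x \<noteq> v" for x
    using that by (simp add: tw twist_def)
  have "0 < ?w x \<and> (\<forall>y. x \<prec> y \<longrightarrow> ?w x < ?w y)" if x: "x \<in> V" "int k < \<bar>?w x\<bar>" for x
  proof (cases "x = u")
    case True
    have "?w u < ?w y" if uy: "u \<prec> y" for y
    proof -
      have y: "y \<noteq> u" "y \<noteq> v"
        using uy forest_less_irrefl forest_le_less_trans[OF move_facts(3) uy] by auto
      have "int (Suc k) < \<bar>w y\<bar>" using move_facts(6)[OF uy] .
      moreover from this have "0 < w y"
        using sorted_above_pos[OF w] forest_less_in_V[OF uy] by simp
      ultimately show ?thesis using move_at_target same[OF y] by simp
    qed
    then show ?thesis using True move_at_target by simp
  next
    case False
    have "x \<noteq> v"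
    proof
      assume xv: "x = v"
      then have "\<bar>?w v\<bar> = \<bar>w u\<bar>"
        using E_abs[OF sgn_in_E] by (simp add: tw twist_def abs_mult)
      then have "\<bar>w u\<bar> = \<bar>w v\<bar>" using x xv move_facts(4,5) by simp
      then show False using sorted_above_inj[OF w] move_facts(1,2) False xv by auto
    qed
    then have wx: "?w x = w x" using same False by simp
    have "int (Suc k) \<noteq> \<bar>w x\<bar>"
      using sorted_above_inj[OF w x(1) move_facts(1)] move_facts(4) \<open>x \<noteq> v\<close> by auto
    then have big: "int (Suc k) < \<bar>w x\<bar>" using x wx by simp
    have "?w x < ?w y" if xy: "x \<prec> y" for y
    proof -
      have "w x < w y" "0 < w x"
        using sorted_above_less[OF w xy big] sorted_above_pos[OF w x(1) big] .
      then have "y \<noteq> u" "y \<noteq> v" using big move_facts(4,5) by auto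
      then show ?thesis using wx same \<open>w x < w y\<close> by simp
    qed
    then show ?thesis using wx sorted_above_pos[OF w x(1) big] by simp
  qed
  then show ?thesis
    using twist_preserves[OF w sgn_in_E move_facts(2,1)]
    unfolding sorted_above_def tw by blast
qed

lemma label_vertex_after: "label_vertex F (sort_move F (Suc k) w) (Suc k) = u"
  using label_vertexI[OF sort_move_sorted move_facts(2), of "Suc k"] move_at_target by simp

lemma subtree_small: "y \<in> subtree F u \<Longrightarrow> \<bar>w y\<bar> \<le> int (Suc k)"
  using sorted_above_down[OF w _ move_facts(5)] by (simp add: subtree_def)

lemma source_in_subtree: "v \<in> subtree F u"
  using move_facts by (simp add: subtree_def)

lemma target_in_subtree: "u \<in> subtree F u"
  using move_facts subtree_refl by simp

lemma sort_move_above: "x \<in> V \<Longrightarrow> int (Suc k) < \<bar>w x\<bar> \<Longrightarrow> sort_move F (Suc k) w x = w x"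
  using move_facts(4,5) by (auto simp: sort_move_twist twist_def)

lemma twist_sort_move: "twist (sgn (w v)) u v (sort_move F (Suc k) w) = w"
  using E_abs[OF sgn_in_E] by (simp add: sort_move_twist twist_twist)

lemma induced_at_target:
  "induced_labeling F w u u = sgn (w v) * induced_labeling F (sort_move F (Suc k) w) u v"
  using induced_labeling_twist[OF E_abs[OF sgn_in_E] target_in_subtree source_in_subtree, of w]
    E_abs[OF sgn_in_E]
  by (auto simp: sort_move_twist abs_if split: if_splits)

text \<open>The label being sorted is the largest one in absolute value in the subtree of its target, so in
  the cost only the signed rank of the label at the target varies.\<close>

lemma rank_source: "\<bar>induced_labeling F w u v\<bar> = int (hook F u)"
proof -
  have "{y \<in> subtree F u. \<bar>w y\<bar> \<le> \<bar>w v\<bar>} = subtree F u"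
    using subtree_small move_facts(4) by auto
  then show ?thesis
    using E_abs[OF sgn_in_E] by (simp add: induced_labeling_def abs_mult hook_def)
qed

lemma sort_cost_eq: "sort_cost F (Suc k) w = cost_of (hook F u) (induced_labeling F w u u)"
proof -
  have "0 < card {y \<in> subtree F u. \<bar>w y\<bar> \<le> \<bar>w u\<bar>}"
    using target_in_subtree by (auto simp: card_gt_0_iff)
  then have "0 < induced_labeling F w u u \<longleftrightarrow> 0 < w u"
    by (auto simp: induced_labeling_def sgn_if zero_less_mult_iff)
  moreover have "sort_cost F (Suc k) w =
      (if 0 < w u then \<bar>induced_labeling F w u v\<bar> - induced_labeling F w u u
       else \<bar>induced_labeling F w u v\<bar> - induced_labeling F w u u - 1)"
    by (simp add: sort_cost_def sort_step_def Let_def flip: v_def u_def)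
  ultimately show ?thesis by (simp add: rank_source cost_of_def)
qed

lemma induced_at_target_nonzero: "induced_labeling F w u u \<noteq> 0"
  using target_in_subtree sorted_above_nonzero[OF w move_facts(2)]
  by (auto simp: induced_labeling_def sgn_if)

lemma sort_cost_nonneg: "0 \<le> sort_cost F (Suc k) w"
proof -
  have "card {y \<in> subtree F u. \<bar>w y\<bar> \<le> \<bar>w u\<bar>} \<le> hook F u"
    unfolding hook_def by (rule card_mono) auto
  moreover have "0 < hook F u" using hook_pos move_facts(2) .
  ultimately show ?thesis
    by (auto simp: sort_cost_eq cost_of_def induced_labeling_def sgn_if)
qed

text \<open>Cost \<open>0\<close> means that the label at the target is positive and has the largest rank in the subtree,
  i.e. that it is the label being sorted.\<close>

lemma sort_cost_eq_0: "sort_cost F (Suc k) w = 0 \<longleftrightarrow> u = v \<and> 0 < w u"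
proof
  let ?B = "{y \<in> subtree F u. \<bar>w y\<bar> \<le> \<bar>w u\<bar>}"
  assume 0: "sort_cost F (Suc k) w = 0"
  have "0 < hook F u" using hook_pos move_facts(2) .
  then have ind: "induced_labeling F w u u = int (hook F u)" "0 < hook F u"
    using 0 induced_at_target_nonzero by (auto simp: sort_cost_eq cost_of_def split: if_splits)
  then have pos: "0 < w u" by (auto simp: induced_labeling_def sgn_if split: if_splits)
  with ind have "card ?B = card (subtree F u)"
    by (simp add: induced_labeling_def hook_def)
  then have "?B = subtree F u" by (intro card_subset_eq) auto
  then have "\<bar>w v\<bar> \<le> \<bar>w u\<bar>" using source_in_subtree by blast
  then have "\<bar>w u\<bar> = \<bar>w v\<bar>" using move_facts(4,5) by simp
  then show "u = v \<and> 0 < w u" using sorted_above_inj[OF w] move_facts(1,2) pos by blast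
next
  assume uv: "u = v \<and> 0 < w u"
  then have "\<bar>induced_labeling F w u u\<bar> = int (hook F u)" using rank_source by simp
  moreover have "0 \<le> induced_labeling F w u u" using uv by (auto simp: induced_labeling_def sgn_if)
  moreover have "0 < hook F u" using hook_pos move_facts(2) .
  ultimately show "sort_cost F (Suc k) w = 0" by (simp add: sort_cost_eq cost_of_def)
qed

end

text \<open>In the other direction, the vertex \<open>v\<close> below \<open>u\<close> and the sign \<open>e\<close> from which the label \<open>Suc k\<close> came can
  be prescribed arbitrarily.\<close>

context
  fixes k w u v e
  assumes k: "Suc k \<le> n" and w: "w \<in> sorted_above k"
    and u_def: "u = label_vertex F w (Suc k)" and v: "v \<in> subtree F u" and e: "e \<in> E"
begin

lemma unmove_facts:
  shows "u \<in> V" "w u = int (Suc k)" "v \<in> V" "v \<preceq> u" "\<bar>w v\<bar> \<le> int (Suc k)"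
proof -
  show u: "u \<in> V" and "w u = int (Suc k)"
    using label_vertex_works[OF w, of "Suc k"] sorted_above_pos[OF w, of u] k
    by (auto simp: u_def)
  show "v \<in> V" "v \<preceq> u" using v by (auto simp: subtree_def)
  then show "\<bar>w v\<bar> \<le> int (Suc k)"
    using sorted_above_down[OF w, of v u "Suc k"] \<open>w u = int (Suc k)\<close> by simp
qed

lemma twist_same: "x \<noteq> u \<Longrightarrow> x \<noteq> v \<Longrightarrow> twist e u v w x = w x"
  by (simp add: twist_def)

lemma above_target:
  assumes "u \<prec> x" shows "int (Suc k) < w x" "x \<noteq> u" "x \<noteq> v"
proof -
  show "int (Suc k) < w x"
    using sorted_above_less[OF w assms] unmove_facts(2) by simp
  then show "x \<noteq> u" "x \<noteq> v" using unmove_facts(2,5) by auto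
qed

lemma unmove_sorted: "twist e u v w \<in> sorted_above (Suc k)"
proof -
  let ?w = "twist e u v w"
  have "0 < ?w x \<and> (\<forall>y. x \<prec> y \<longrightarrow> ?w x < ?w y)" if x: "x \<in> V" "int (Suc k) < \<bar>?w x\<bar>" for x
  proof -
    have ne: "x \<noteq> u" "x \<noteq> v"
      using x(2) unmove_facts(2,5) abs_twist[OF E_abs[OF e], of u v w x] by auto
    then have wx: "?w x = w x" by (rule twist_same)
    then have big: "int k < \<bar>w x\<bar>" "int (Suc k) < \<bar>w x\<bar>" using x(2) by auto
    have pos: "0 < w x" using sorted_above_pos[OF w x(1) big(1)] .
    have "?w x < ?w y" if xy: "x \<prec> y" for y
    proof -
      have less: "w x < w y" using sorted_above_less[OF w xy big(1)] .
      then have "y \<noteq> u" "y \<noteq> v" using pos big unmove_facts(2,5) by auto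
      then show ?thesis using less wx twist_same by simp
    qed
    then show ?thesis using wx pos by simp
  qed
  then show ?thesis
    using twist_preserves[OF w e unmove_facts(1,3)] unfolding sorted_above_def by blast
qed

lemma unmove_at_source: "twist e u v w v = e * int (Suc k)"
  using unmove_facts(2) by (simp add: twist_def)

lemma label_vertex_unmove: "label_vertex F (twist e u v w) (Suc k) = v"
  using label_vertexI[OF unmove_sorted unmove_facts(3)] E_abs[OF e]
  by (simp add: unmove_at_source abs_mult)

lemma target_vertex_unmove: "target_vertex F (twist e u v w) (Suc k) = u"
proof (rule target_vertexI[OF label_vertex_unmove unmove_facts(1,4)])
  show "\<bar>twist e u v w u\<bar> \<le> int (Suc k)"
    using abs_twist[OF E_abs[OF e], of u v w u] unmove_facts(5) by simp
  show "int (Suc k) < \<bar>twist e u v w x\<bar>" if "u \<prec> x" for x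
    using above_target[OF that] twist_same by simp
qed

lemma sgn_unmove: "sgn (twist e u v w v) = e"
  using E_sgn[OF e] by (simp add: unmove_at_source sgn_mult)

lemma sort_move_unmove: "sort_move F (Suc k) (twist e u v w) = w"
  using sort_move_twist[OF k unmove_sorted label_vertex_unmove[symmetric]
      target_vertex_unmove[symmetric]]
  by (simp add: sgn_unmove twist_twist E_abs[OF e])

end


section \<open>The costs of the inverses of a pass\<close>

lemma card_E_cases:
  obtains "E = {1}" "card E = 1" | "E = {1, -1}" "card E = 2"
  using E_cases by auto

text \<open>The signed rank \<open>e * induced_labeling F w u v\<close> determines \<open>v\<close> through its absolute value and then
  \<open>e\<close> through its sign, so the costs of different choices differ; being bounded by the number of
  choices, they exhaust all possible values.\<close>

lemma cost_bij:
  assumes w: "w \<in> sorted_above k" and u: "u \<in> V"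
  shows "bij_betw (\<lambda>(v, e). nat (cost_of (hook F u) (e * induced_labeling F w u v)))
    (subtree F u \<times> E) {..<card E * hook F u}"
proof -
  let ?S = "subtree F u" and ?h = "hook F u"
  let ?s = "\<lambda>(v, e). e * induced_labeling F w u v"
  define r where "r v = card {y \<in> ?S. \<bar>w y\<bar> \<le> \<bar>w v\<bar>}" for v
  have SV: "v \<in> V" if "v \<in> ?S" for v using that by (simp add: subtree_def)
  have r_range: "1 \<le> r v \<and> r v \<le> ?h" if "v \<in> ?S" for v
  proof -
    have "r v \<le> ?h" unfolding r_def hook_def by (rule card_mono) auto
    moreover have "0 < r v" using that by (auto simp: r_def card_gt_0_iff)
    ultimately show ?thesis by simp
  qed
  have r_less: "r a < r b" if "b \<in> ?S" "\<bar>w a\<bar> < \<bar>w b\<bar>" for a b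
  proof -
    have "b \<notin> {y \<in> ?S. \<bar>w y\<bar> \<le> \<bar>w a\<bar>}" "b \<in> {y \<in> ?S. \<bar>w y\<bar> \<le> \<bar>w b\<bar>}" using that by auto
    moreover have "{y \<in> ?S. \<bar>w y\<bar> \<le> \<bar>w a\<bar>} \<subseteq> {y \<in> ?S. \<bar>w y\<bar> \<le> \<bar>w b\<bar>}"
      using that by auto
    ultimately show ?thesis unfolding r_def by (intro psubset_card_mono psubsetI) auto
  qed
  have r_inj: "a = b" if "a \<in> ?S" "b \<in> ?S" "r a = r b" for a b
  proof -
    have "\<bar>w a\<bar> = \<bar>w b\<bar>"
      using r_less[OF that(1), of b] r_less[OF that(2), of a] that(3) by linarith
    then show ?thesis using sorted_above_inj[OF w] SV that by blast
  qed
  have s_eq: "?s (v, e) = (e * sgn (w v)) * int (r v)" for v e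
    by (simp add: induced_labeling_def r_def)
  have sg: "e * sgn (w v) \<in> E" if "v \<in> ?S" "e \<in> E" for v e
    using E_mult sorted_above_sgn[OF w] SV that by blast
  have abs_s: "\<bar>?s (v, e)\<bar> = int (r v)" if "v \<in> ?S" "e \<in> E" for v e
    unfolding s_eq using E_abs[OF sg[OF that]] by (simp add: abs_mult)
  have s_pos: "0 < ?s (v, e)" if "v \<in> ?S" "e \<in> E" "E = {1}" for v e
    unfolding s_eq using sg[OF that(1,2)] r_range[OF that(1)] that(3) by auto
  let ?c = "\<lambda>x. nat (cost_of ?h (?s x))"
  have inj: "inj_on ?c (?S \<times> E)"
  proof (rule inj_onI)
    fix x y assume xy: "x \<in> ?S \<times> E" "y \<in> ?S \<times> E" "?c x = ?c y"
    obtain a e b e' where x: "x = (a, e)" and y: "y = (b, e')" by (metis surj_pair)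
    have ab: "a \<in> ?S" "e \<in> E" "b \<in> ?S" "e' \<in> E" and c: "?c (a, e) = ?c (b, e')"
      using xy unfolding x y by blast+
    have "?s (a, e) = ?s (b, e')"
      \<comment> \<open>Positive signed ranks cost less than \<open>?h\<close>, negative ones at least \<open>?h\<close>.\<close>
      using c abs_s[OF ab(1,2)] abs_s[OF ab(3,4)] r_range[OF ab(1)] r_range[OF ab(3)]
      unfolding cost_of_def by (auto simp del: case_prod_conv split: if_splits)
    then have s: "?s (a, e) = ?s (b, e')" "r a = r b"
      using abs_s[OF ab(1,2)] abs_s[OF ab(3,4)] by simp_all
    then have "a = b" using r_inj ab by blast
    have "(e * sgn (w b)) * int (r b) = (e' * sgn (w b)) * int (r b)"
      using s(1) unfolding s_eq \<open>a = b\<close> .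
    then have "e = e'"
      using r_range[OF ab(3)] sorted_above_nonzero[OF w SV[OF ab(3)]] by (auto simp: sgn_eq_0_iff)
    then show "x = y" using \<open>a = b\<close> x y by simp
  qed
  have "?c ` (?S \<times> E) \<subseteq> {..<card E * ?h}"
  proof
    fix c assume "c \<in> ?c ` (?S \<times> E)"
    then obtain v e where ve: "v \<in> ?S" "e \<in> E" "c = ?c (v, e)" by blast
    show "c \<in> {..<card E * ?h}"
      using ve(3) abs_s[OF ve(1,2)] r_range[OF ve(1)] s_pos[OF ve(1,2)]
      by (cases rule: card_E_cases) (auto simp: cost_of_def simp del: case_prod_conv)
  qed
  moreover have "card (?c ` (?S \<times> E)) = card {..<card E * ?h}"
    using card_image[OF inj] by (simp add: hook_def card_cartesian_product mult.commute)
  ultimately have "?c ` (?S \<times> E) = {..<card E * ?h}"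
    by (rule card_subset_eq[OF finite_lessThan])
  with inj have "bij_betw ?c (?S \<times> E) {..<card E * ?h}" by (simp add: bij_betw_def)
  then show ?thesis by (simp add: split_def)
qed


section \<open>Weighted sums over labelings\<close>

lemma finite_sorted_above [simp]: "finite (sorted_above k)"
proof (rule finite_subset)
  show "sorted_above k \<subseteq> V \<rightarrow>\<^sub>E {- int n..int n}"
  proof
    fix w assume w: "w \<in> sorted_above k"
    then have "w x \<in> {- int n..int n}" if "x \<in> V" for x
      using sorted_above_range[OF w that] by auto
    then show "w \<in> V \<rightarrow>\<^sub>E {- int n..int n}"
      using sorted_above_ext[OF w] by (auto simp: PiE_def)
  qed
qed (simp add: finite_PiE)

text \<open>A labeling before the pass corresponds to a labeling \<open>w\<close> after it together with a choice \<open>(v, e)\<close>,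
  and the choices can be replaced by their costs.\<close>

lemma sum_one_move:
  fixes f :: "'v \<Rightarrow> nat \<Rightarrow> 'a::comm_semiring_1"
  assumes k: "Suc k \<le> n"
  shows "(\<Sum>w\<in>sorted_above (Suc k).
      f (target_vertex F w (Suc k)) (nat (sort_cost F (Suc k) w)) * G (sort_move F (Suc k) w)) =
    (\<Sum>w\<in>sorted_above k.
      (\<Sum>c<card E * hook F (label_vertex F w (Suc k)). f (label_vertex F w (Suc k)) c) * G w)"
proof -
  define lv where "lv w = label_vertex F w (Suc k)" for w
  define ind where "ind w v = induced_labeling F w (lv w) v" for w v
  have "(\<Sum>w\<in>sorted_above (Suc k).
      f (target_vertex F w (Suc k)) (nat (sort_cost F (Suc k) w)) * G (sort_move F (Suc k) w)) =
    (\<Sum>(w, v, e)\<in>Sigma (sorted_above k) (\<lambda>w. subtree F (lv w) \<times> E).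
      f (lv w) (nat (cost_of (hook F (lv w)) (e * ind w v))) * G w)"
  proof (rule sum.reindex_bij_witness[where
        i = "\<lambda>(w, v, e). twist e (lv w) v w" and
        j = "\<lambda>w. (sort_move F (Suc k) w, lv w, sgn (w (lv w)))"])
    fix w assume w: "w \<in> sorted_above (Suc k)"
    note R = k w lv_def refl
    show "(case (sort_move F (Suc k) w, lv w, sgn (w (lv w))) of (w, v, e) \<Rightarrow> twist e (lv w) v w) = w"
      using twist_sort_move[OF R] label_vertex_after[OF R] by (simp add: lv_def)
    show "(sort_move F (Suc k) w, lv w, sgn (w (lv w))) \<in>
        Sigma (sorted_above k) (\<lambda>w. subtree F (lv w) \<times> E)"
      using sort_move_sorted[OF R] source_in_subtree[OF R] sgn_in_E[OF R] label_vertex_after[OF R]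
      by (simp add: lv_def)
    show "(case (sort_move F (Suc k) w, lv w, sgn (w (lv w))) of
          (w, v, e) \<Rightarrow> f (lv w) (nat (cost_of (hook F (lv w)) (e * ind w v))) * G w) =
        f (target_vertex F w (Suc k)) (nat (sort_cost F (Suc k) w)) * G (sort_move F (Suc k) w)"
      using sort_cost_eq[OF R] induced_at_target[OF R] label_vertex_after[OF R]
      by (simp add: lv_def ind_def)
  next
    fix x assume "x \<in> Sigma (sorted_above k) (\<lambda>w. subtree F (lv w) \<times> E)"
    then obtain w v e where x: "x = (w, v, e)" "w \<in> sorted_above k" "v \<in> subtree F (lv w)" "e \<in> E"
      by auto
    note R = k x(2) lv_def x(3,4)
    show "(case x of (w, v, e) \<Rightarrow> twist e (lv w) v w) \<in> sorted_above (Suc k)"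
      using unmove_sorted[OF R] by (simp add: x)
    show "(sort_move F (Suc k) (case x of (w, v, e) \<Rightarrow> twist e (lv w) v w),
        lv (case x of (w, v, e) \<Rightarrow> twist e (lv w) v w),
        sgn ((case x of (w, v, e) \<Rightarrow> twist e (lv w) v w)
          (lv (case x of (w, v, e) \<Rightarrow> twist e (lv w) v w)))) = x"
      using sort_move_unmove[OF R] label_vertex_unmove[OF R] sgn_unmove[OF R]
      by (simp add: x lv_def)
  qed
  also have "\<dots> = (\<Sum>w\<in>sorted_above k. \<Sum>(v, e)\<in>subtree F (lv w) \<times> E.
      f (lv w) (nat (cost_of (hook F (lv w)) (e * ind w v))) * G w)"
    by (subst sum.Sigma) (auto simp: split_def)
  also have "\<dots> = (\<Sum>w\<in>sorted_above k. (\<Sum>c<card E * hook F (lv w). f (lv w) c) * G w)"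
  proof (rule sum.cong[OF refl])
    fix w assume w: "w \<in> sorted_above k"
    have "lv w \<in> V" using label_vertex_works[OF w] k by (simp add: lv_def)
    note bij = cost_bij[OF w this]
    show "(\<Sum>(v, e)\<in>subtree F (lv w) \<times> E.
          f (lv w) (nat (cost_of (hook F (lv w)) (e * ind w v))) * G w) =
        (\<Sum>c<card E * hook F (lv w). f (lv w) c) * G w"
      using sum.reindex_bij_betw[OF bij, of "\<lambda>c. f (lv w) c * G w"]
      by (simp add: split_def ind_def sum_distrib_right)
  qed
  finally show ?thesis by (simp add: lv_def)
qed

text \<open>The sum does not depend on \<open>k\<close>: a vertex with a label above \<open>k\<close> has its final label already, and the
  sum over the choices for its pass has been replaced by \<open>g\<close>.\<close>

lemma sum_run_weight:
  fixes f :: "'v \<Rightarrow> nat \<Rightarrow> 'a::comm_semiring_1"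
  defines "g \<equiv> \<lambda>v. \<Sum>c<card E * hook F v. f v c"
  assumes "k \<le> n"
  shows "(\<Sum>w\<in>sorted_above k. run_weight F f k w * (\<Prod>x | x \<in> V \<and> int k < \<bar>w x\<bar>. g x)) =
    of_nat (card (sorted_above 0)) * (\<Prod>x\<in>V. g x)"
  using \<open>k \<le> n\<close>
proof (induction k)
  case 0
  have "{x. x \<in> V \<and> int 0 < \<bar>w x\<bar>} = V" if "w \<in> sorted_above 0" for w
    using sorted_above_nonzero[OF that] by auto
  then show ?case by simp
next
  case (Suc k)
  define P where "P i w = (\<Prod>x | x \<in> V \<and> int i < \<bar>w x\<bar>. g x)" for i and w :: "'v \<Rightarrow> int"
  have "(\<Sum>w\<in>sorted_above (Suc k). run_weight F f (Suc k) w * P (Suc k) w) =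
    (\<Sum>w\<in>sorted_above (Suc k). f (target_vertex F w (Suc k)) (nat (sort_cost F (Suc k) w)) *
      (run_weight F f k (sort_move F (Suc k) w) * P (Suc k) (sort_move F (Suc k) w)))"
  proof (rule sum.cong[OF refl])
    fix w assume w: "w \<in> sorted_above (Suc k)"
    note R = Suc.prems w refl refl
    have "{x. x \<in> V \<and> int (Suc k) < \<bar>w x\<bar>} =
        {x. x \<in> V \<and> int (Suc k) < \<bar>sort_move F (Suc k) w x\<bar>}"
    proof (intro Collect_cong conj_cong refl)
      fix x
      show "int (Suc k) < \<bar>w x\<bar> \<longleftrightarrow> int (Suc k) < \<bar>sort_move F (Suc k) w x\<bar>"
        using move_facts(4,5)[OF R] unfolding sort_move_twist[OF R] abs_twist[OF E_abs[OF sgn_in_E[OF R]]]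
        by (auto simp: transpose_def)
    qed
    then show "run_weight F f (Suc k) w * P (Suc k) w =
      f (target_vertex F w (Suc k)) (nat (sort_cost F (Suc k) w)) *
        (run_weight F f k (sort_move F (Suc k) w) * P (Suc k) (sort_move F (Suc k) w))"
      by (simp add: P_def mult.assoc)
  qed
  also have "\<dots> = (\<Sum>w\<in>sorted_above k. g (label_vertex F w (Suc k)) *
      (run_weight F f k w * P (Suc k) w))"
    unfolding g_def by (rule sum_one_move[OF Suc.prems, of f "\<lambda>w. run_weight F f k w * P (Suc k) w"])
  also have "\<dots> = (\<Sum>w\<in>sorted_above k. run_weight F f k w * P k w)"
  proof (rule sum.cong[OF refl])
    fix w assume w: "w \<in> sorted_above k"
    define u where "u = label_vertex F w (Suc k)"
    have u: "u \<in> V" "\<bar>w u\<bar> = int (Suc k)"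
      using label_vertex_works[OF w, of "Suc k"] Suc.prems by (auto simp: u_def)
    have "{x. x \<in> V \<and> int k < \<bar>w x\<bar>} = insert u {x. x \<in> V \<and> int (Suc k) < \<bar>w x\<bar>}"
    proof (intro set_eqI iffI)
      fix x assume x: "x \<in> {x. x \<in> V \<and> int k < \<bar>w x\<bar>}"
      show "x \<in> insert u {x. x \<in> V \<and> int (Suc k) < \<bar>w x\<bar>}"
      proof (cases "\<bar>w x\<bar> = \<bar>w u\<bar>")
        case True
        then show ?thesis using sorted_above_inj[OF w _ u(1)] x by blast
      next
        case False
        then show ?thesis using x u(2) by simp
      qed
    qed (use u in auto)
    then have "P k w = g u * P (Suc k) w"
      using u by (simp add: P_def)
    then show "g (label_vertex F w (Suc k)) * (run_weight F f k w * P (Suc k) w) =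
        run_weight F f k w * P k w"
      by (simp add: u_def mult_ac)
  qed
  also have "\<dots> = of_nat (card (sorted_above 0)) * (\<Prod>x\<in>V. g x)"
    using Suc by (simp add: P_def)
  finally show ?case by (simp add: P_def)
qed

lemma sorted_above_0: "sorted_above 0 = natural_labelings"
proof (intro set_eqI iffI)
  fix w assume w: "w \<in> sorted_above 0"
  have pos: "0 < w x" if "x \<in> V" for x
    using sorted_above_pos[OF w that] sorted_above_nonzero[OF w that] by simp
  have "bij_betw w V {1..int n} \<longleftrightarrow> bij_betw (\<lambda>x. \<bar>w x\<bar>) V {1..int n}"
    using pos by (intro bij_betw_cong) force
  moreover have "w x < w y" if "x \<prec> y" for x y
    using sorted_above_less[OF w that] sorted_above_nonzero[OF w] forest_less_in_V[OF that] by simp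
  ultimately show "w \<in> natural_labelings"
    using sorted_above_bij[OF w] sorted_above_ext[OF w] by (auto simp: natural_labelings_def)
next
  fix b assume b: "b \<in> natural_labelings"
  then have pos: "0 < b x" if "x \<in> V" for x
    using that bij_betwE[of b V "{1..int n}"] by (force simp: natural_labelings_def)
  have "bij_betw (\<lambda>x. \<bar>b x\<bar>) V {1..int n} \<longleftrightarrow> bij_betw b V {1..int n}"
    using pos by (intro bij_betw_cong) force
  moreover have "sgn (b x) \<in> E" if "x \<in> V" for x
    using pos[OF that] E_cases by (auto simp: sgn_if)
  ultimately show "b \<in> sorted_above 0"
    using b pos by (auto simp: natural_labelings_def sorted_above_def)
qed


section \<open>The cycles affected by a pass\<close>

lemma sort_down_natural_aux:
  assumes "w \<in> sorted_above k" "k \<le> n"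
  shows "sort_down F k w \<in> natural_labelings \<and>
    (\<forall>x\<in>V. int k < \<bar>w x\<bar> \<longrightarrow> sort_down F k w x = w x)"
  using assms
proof (induction k arbitrary: w)
  case 0
  then show ?case by (simp add: sorted_above_0)
next
  case (Suc k)
  note R = Suc.prems(2,1) refl refl
  note IH = Suc.IH[OF sort_move_sorted[OF R]]
  have "sort_down F (Suc k) w x = w x" if x: "x \<in> V" "int (Suc k) < \<bar>w x\<bar>" for x
    using IH Suc.prems(2) x sort_move_above[OF R x] by simp
  then show ?case using IH Suc.prems(2) by simp
qed

lemmas sort_down_natural = sort_down_natural_aux[THEN conjunct1]
  and sort_down_above = sort_down_natural_aux[THEN conjunct2, rule_format]

context
  fixes b assumes b: "b \<in> natural_labelings"
begin

lemma natural_bij: "bij_betw b V {1..int n}"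
  using b by (simp add: natural_labelings_def)

lemma natural_range: "x \<in> V \<Longrightarrow> 1 \<le> b x \<and> b x \<le> int n"
  using bij_betwE[OF natural_bij] by auto

lemma natural_inj: "x \<in> V \<Longrightarrow> y \<in> V \<Longrightarrow> b x = b y \<Longrightarrow> x = y"
  using natural_bij by (auto simp: bij_betw_def dest: inj_onD)

lemma label_perm_apply: "x \<in> V \<Longrightarrow> label_perm F w b (b x) = w x"
  using natural_range[of x] inv_into_f_f[OF bij_betw_imp_inj_on[OF natural_bij]]
  by (simp add: label_perm_def signed_ext_def)

lemma signed_cases:
  assumes "\<bar>y\<bar> \<le> int n"
  obtains "y = 0" | x where "x \<in> V" "y = b x" | x where "x \<in> V" "y = - b x"
proof (cases "y = 0")
  case False
  then have "\<bar>y\<bar> \<in> b ` V" using natural_bij assms by (simp add: bij_betw_def)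
  then obtain x where "x \<in> V" "\<bar>y\<bar> = b x" by auto
  then show ?thesis using that by (cases "0 < y") auto
qed (use that in simp)

lemma label_perm_permutes:
  assumes w: "w \<in> sorted_above k"
  shows "label_perm F w b permutes ({- int n..int n} - {0})" (is "?p permutes ?S")
proof (rule bij_imp_permutes)
  show "?p y = y" if "y \<notin> ?S" for y
    using that by (auto simp: label_perm_def signed_ext_def)
  have sub: "?p ` ?S \<subseteq> ?S"
  proof
    fix z assume "z \<in> ?p ` ?S"
    then obtain y where y: "y \<in> ?S" "z = ?p y" by blast
    then have "\<bar>y\<bar> \<le> int n" by auto
    then show "z \<in> ?S"
    proof (cases y rule: signed_cases)
      case (2 x)
      then show ?thesis using y sorted_above_range[OF w, of x] by (auto simp: label_perm_apply)
    next
      case (3 x)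
      then show ?thesis using y sorted_above_range[OF w, of x]
        by (auto simp: label_perm_apply label_perm_uminus)
    qed (use y in auto)
  qed
  have sup: "?S \<subseteq> ?p ` ?S"
  proof
    fix z assume z: "z \<in> ?S"
    then have "\<bar>z\<bar> \<in> (\<lambda>x. \<bar>w x\<bar>) ` V" using sorted_above_bij[OF w] by (auto simp: bij_betw_def)
    then obtain x where x: "x \<in> V" "\<bar>z\<bar> = \<bar>w x\<bar>" by auto
    have "b x \<in> ?S" "- b x \<in> ?S" using natural_range[OF x(1)] by auto
    moreover have "z = ?p (b x) \<or> z = ?p (- b x)"
      using x by (auto simp: label_perm_apply label_perm_uminus)
    ultimately show "z \<in> ?p ` ?S" by blast
  qed
  have "inj_on ?p ?S" by (rule finite_surj_inj[OF _ sup]) simp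
  then show "bij_betw ?p ?S ?S" using sub sup by (simp add: bij_betw_def subset_antisym)
qed

end

context
  fixes k w b u v
  assumes k: "Suc k \<le> n" and w: "w \<in> sorted_above (Suc k)"
    and b_def: "b = sort_down F (Suc k) w"
    and v_def: "v = label_vertex F w (Suc k)" and u_def: "u = target_vertex F w (Suc k)"
begin

lemmas this_step = k w v_def u_def

lemma result_natural: "b \<in> natural_labelings"
  using sort_down_natural[OF w k] by (simp add: b_def)

lemma result_above: "x \<in> V \<Longrightarrow> int k < \<bar>sort_move F (Suc k) w x\<bar> \<Longrightarrow> b x = sort_move F (Suc k) w x"
  using sort_down_above[OF sort_move_sorted[OF this_step]] k by (simp add: b_def)

lemma result_at_target: "b u = int (Suc k)"
  using result_above[OF move_facts(2)[OF this_step]] move_at_target[OF this_step] by simp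

text \<open>The image of \<open>Suc k\<close> is the label of the target before the pass, which is \<open>Suc k\<close> exactly if the pass
  is trivial, and otherwise is \<open>- Suc k\<close> or smaller in absolute value.\<close>

lemma balanced_min_new:
  "balanced_min (label_perm F w b) (int (Suc k)) \<longleftrightarrow> sort_cost F (Suc k) w = 0"
proof -
  have p: "label_perm F w b (int (Suc k)) = w u"
    using label_perm_apply[OF result_natural move_facts(2)[OF this_step]] result_at_target by simp
  have "balanced_min (label_perm F w b) (int (Suc k)) \<longleftrightarrow> w u = int (Suc k)"
  proof
    assume "balanced_min (label_perm F w b) (int (Suc k))"
    moreover have "w u \<in> orbit (label_perm F w b) (int (Suc k))"
      using orbit.base[of "label_perm F w b" "int (Suc k)"] p by simp
    ultimately show "w u = int (Suc k)"
      using move_facts(5)[OF this_step] unfolding balanced_min_def by force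
  next
    assume "w u = int (Suc k)"
    then have "orbit (label_perm F w b) (int (Suc k)) = {int (Suc k)}"
      using p by (simp add: orbit_eq_singleton_iff)
    then show "balanced_min (label_perm F w b) (int (Suc k))" by (simp add: balanced_min_def)
  qed
  also have "\<dots> \<longleftrightarrow> u = v \<and> 0 < w u"
  proof
    assume u: "w u = int (Suc k)"
    then show "u = v \<and> 0 < w u"
      using sorted_above_inj[OF w move_facts(2,1)[OF this_step]] move_facts(4)[OF this_step] by simp
  qed (use move_facts(4)[OF this_step] in auto)
  finally show ?thesis using sort_cost_eq_0[OF this_step] by simp
qed

text \<open>Undoing the pass inserts \<open>Suc k\<close> and \<open>- Suc k\<close> behind the final label of \<open>v\<close> and its negative, or
  leaves the images of all smaller numbers unchanged if \<open>u = v\<close>.\<close>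

lemma balanced_min_old:
  assumes m: "0 < m" "m \<le> int k"
  shows "balanced_min (label_perm F w b) m \<longleftrightarrow>
    balanced_min (label_perm F (sort_move F (Suc k) w) b) m"
proof (rule balanced_min_bypass[where i = "int (Suc k)"])
  let ?w = "sort_move F (Suc k) w"
  let ?p = "label_perm F w b" and ?p' = "label_perm F ?w b"
  note p = label_perm_apply[OF result_natural]
  have inner: "\<bar>?w x\<bar> < int (Suc k)" if x: "x \<in> V" "b x < int (Suc k)" for x
  proof (rule ccontr)
    assume "\<not> \<bar>?w x\<bar> < int (Suc k)"
    then have "int k < \<bar>?w x\<bar>" "int (Suc k) \<le> \<bar>?w x\<bar>" by auto
    moreover from this have "0 < ?w x" using sorted_above_pos[OF sort_move_sorted[OF this_step] x(1)] by simp
    ultimately show False using result_above[OF x(1)] x(2) by simp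
  qed
  have detour: "w x = ?w x \<or> \<bar>w x\<bar> = int (Suc k) \<and> ?p (w x) = ?w x"
    if x: "x \<in> V" "b x < int (Suc k)" for x
  proof (cases "x = v")
    case True
    have "u \<noteq> v" using x True result_at_target by auto
    have "?p (int (Suc k)) = w u" using p[OF move_facts(2)[OF this_step]] result_at_target by simp
    moreover have "?w v = sgn (w v) * w u"
      by (simp add: sort_move_twist[OF this_step] twist_def)
    moreover have "w v = int (Suc k) \<or> w v = - int (Suc k)"
      using move_facts(4)[OF this_step] by linarith
    ultimately have "?p (w v) = ?w v"
      using label_perm_uminus[of F w b "int (Suc k)"] by (auto simp del: of_nat_Suc)
    then show ?thesis using True move_facts(4)[OF this_step] by simp
  next
    case False
    have "x \<noteq> u" using x result_at_target by auto
    then show ?thesis using False by (simp add: sort_move_twist[OF this_step] twist_def)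
  qed
  show "\<bar>m\<bar> < int (Suc k)" using m by simp
  fix y :: int assume y: "\<bar>y\<bar> < int (Suc k)"
  then have "\<bar>y\<bar> \<le> int n" using k by simp
  then have "\<bar>?p' y\<bar> < int (Suc k) \<and>
      (?p y = ?p' y \<or> \<bar>?p y\<bar> = int (Suc k) \<and> ?p (?p y) = ?p' y)"
  proof (cases y rule: signed_cases[OF result_natural, consumes 1])
    case 1
    then show ?thesis by (simp add: label_perm_def signed_ext_def)
  next
    case (2 x)
    then show ?thesis using inner[of x] detour[of x] y p[of x] by auto
  next
    case (3 x)
    then show ?thesis using inner[of x] detour[of x] y p[of x]
      by (auto simp: label_perm_uminus)
  qed
  then show "\<bar>?p' y\<bar> < int (Suc k)" and "?p y = ?p' y \<or> \<bar>?p y\<bar> = int (Suc k) \<and> ?p (?p y) = ?p' y"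
    by blast+
qed

end


section \<open>The cycle statistic along a run\<close>

text \<open>The vertices of the cycle statistic among the targets of the \<open>k\<close> remaining passes; for \<open>k = n\<close> this
  is the full cycle statistic (\<open>Cyc_B_eq\<close>, \<open>Cyc_eq\<close>).\<close>

definition Cyc_upto :: "nat \<Rightarrow> ('v \<Rightarrow> int) \<Rightarrow> 'v set" where
  "Cyc_upto k w = {x \<in> V. sort_down F k w x \<le> int k \<and>
     balanced_min (label_perm F w (sort_down F k w)) (sort_down F k w x)}"

lemma Cyc_upto_Suc:
  assumes k: "Suc k \<le> n" and w: "w \<in> sorted_above (Suc k)"
  defines "u \<equiv> target_vertex F w (Suc k)"
  shows "Cyc_upto (Suc k) w = Cyc_upto k (sort_move F (Suc k) w) \<union>
      (if sort_cost F (Suc k) w = 0 then {u} else {})"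
    and "u \<notin> Cyc_upto k (sort_move F (Suc k) w)"
proof -
  note R = k w refl refl
  define b where "b = sort_down F (Suc k) w"
  have b': "sort_down F k (sort_move F (Suc k) w) = b" by (simp add: b_def)
  note S = k w b_def refl refl
  have nat: "b \<in> natural_labelings" using result_natural[OF S] .
  have u: "u \<in> V" "b u = int (Suc k)"
    using move_facts(2)[OF R] result_at_target[OF S] by (simp_all add: u_def)
  show "u \<notin> Cyc_upto k (sort_move F (Suc k) w)"
    unfolding Cyc_upto_def b' using u by simp
  have "x \<in> Cyc_upto (Suc k) w \<longleftrightarrow> x \<in> Cyc_upto k (sort_move F (Suc k) w) \<or>
      sort_cost F (Suc k) w = 0 \<and> x = u" for x
  proof (cases "x = u")
    case True
    then show ?thesis
      using u balanced_min_new[OF S] unfolding Cyc_upto_def b' b_def[symmetric] by simp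
  next
    case False
    show ?thesis
    proof (cases "x \<in> V")
      case True
      have "b x \<noteq> int (Suc k)" using natural_inj[OF nat True u(1)] False u(2) by auto
      then have le: "b x \<le> int (Suc k) \<longleftrightarrow> b x \<le> int k" by auto
      have "0 < b x" using natural_range[OF nat True] by simp
      then show ?thesis
        using False le balanced_min_old[OF S, of "b x"]
        unfolding Cyc_upto_def b' b_def[symmetric] by auto
    qed (simp add: Cyc_upto_def False)
  qed
  then show "Cyc_upto (Suc k) w = Cyc_upto k (sort_move F (Suc k) w) \<union>
      (if sort_cost F (Suc k) w = 0 then {u} else {})"
    by auto
qed

lemma total_cost_nonneg: "w \<in> sorted_above k \<Longrightarrow> k \<le> n \<Longrightarrow> 0 \<le> total_cost F k w"
proof (induction k arbitrary: w)
  case (Suc k)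
  note R = Suc.prems(2,1) refl refl
  show ?case
    using Suc.IH[OF sort_move_sorted[OF R]] sort_cost_nonneg[OF R] Suc.prems(2) by simp
qed simp

text \<open>With weight \<open>t u\<close> for passes of cost \<open>0\<close> and \<open>q ^ c\<close> for passes of cost \<open>c > 0\<close>, the weight of a run
  records both statistics, since the vertices counted by the cycle statistic are the targets of
  the passes of cost \<open>0\<close>.\<close>

lemma run_weight_statistics:
  fixes q :: "'a::comm_semiring_1"
  assumes "w \<in> sorted_above k" "k \<le> n"
  shows "run_weight F (\<lambda>v c. if c = 0 then t v else q ^ c) k w =
    q ^ nat (total_cost F k w) * (\<Prod>v\<in>Cyc_upto k w. t v)"
  using assms
proof (induction k arbitrary: w)
  case 0
  have "Cyc_upto 0 w = {}"
    using natural_range[of w] 0 by (force simp: Cyc_upto_def sorted_above_0)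
  then show ?case by simp
next
  case (Suc k)
  note R = Suc.prems(2,1) refl refl
  define w' where "w' = sort_move F (Suc k) w"
  define u where "u = target_vertex F w (Suc k)"
  have w': "w' \<in> sorted_above k" unfolding w'_def by (rule sort_move_sorted[OF R])
  have k: "k \<le> n" using Suc.prems by simp
  have fin: "finite (Cyc_upto k w')" by (simp add: Cyc_upto_def)
  have nonneg: "0 \<le> total_cost F k w'" "0 \<le> sort_cost F (Suc k) w"
    using total_cost_nonneg[OF w' k] sort_cost_nonneg[OF R] .
  note split = Cyc_upto_Suc[OF Suc.prems(2,1), folded w'_def u_def]
  show ?case
  proof (cases "sort_cost F (Suc k) w = 0")
    case True
    then show ?thesis
      using Suc.IH[OF w' k] split fin by (simp add: w'_def u_def mult_ac)
  next
    case False
    then have "nat (sort_cost F (Suc k) w) \<noteq> 0" using nonneg by simp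
    then show ?thesis
      using Suc.IH[OF w' k] split(1) False nonneg
      by (simp add: w'_def nat_add_distrib power_add mult_ac)
  qed
qed

lemma sum_statistics:
  fixes q :: "'a::comm_ring_1"
  shows "(\<Sum>w\<in>sorted_above n. q ^ nat (total_cost F n w) * (\<Prod>v\<in>Cyc_upto n w. t v)) =
    of_nat (card natural_labelings) * (\<Prod>v\<in>V. (\<Sum>i<card E * hook F v. q ^ i) - 1 + t v)"
proof -
  let ?f = "\<lambda>v c. if c = 0 then t v else q ^ c"
  have "(\<Sum>w\<in>sorted_above n. q ^ nat (total_cost F n w) * (\<Prod>v\<in>Cyc_upto n w. t v)) =
      (\<Sum>w\<in>sorted_above n. run_weight F ?f n w * (\<Prod>x | x \<in> V \<and> int n < \<bar>w x\<bar>.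
        \<Sum>c<card E * hook F x. ?f x c))"
  proof (rule sum.cong[OF refl])
    fix w assume w: "w \<in> sorted_above n"
    have none: "{x. x \<in> V \<and> int n < \<bar>w x\<bar>} = {}" using sorted_above_range[OF w] by force
    then show "q ^ nat (total_cost F n w) * (\<Prod>v\<in>Cyc_upto n w. t v) =
      run_weight F ?f n w * (\<Prod>x | x \<in> V \<and> int n < \<bar>w x\<bar>. \<Sum>c<card E * hook F x. ?f x c)"
      unfolding none using run_weight_statistics[OF w, of t q] by simp
  qed
  also have "\<dots> = of_nat (card natural_labelings) *
      (\<Prod>v\<in>V. \<Sum>c<card E * hook F v. ?f v c)"
    using sum_run_weight[of n ?f] by (simp add: sorted_above_0)
  also have "(\<Prod>v\<in>V. \<Sum>c<card E * hook F v. ?f v c) =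
      (\<Prod>v\<in>V. (\<Sum>i<card E * hook F v. q ^ i) - 1 + t v)"
  proof (rule prod.cong[OF refl])
    fix v assume "v \<in> V"
    then have "0 < card E * hook F v" using hook_pos E_cases by auto
    then obtain m where "card E * hook F v = Suc m" by (auto simp: gr0_conv_Suc)
    then show "(\<Sum>c<card E * hook F v. ?f v c) = (\<Sum>i<card E * hook F v. q ^ i) - 1 + t v"
      by (simp add: sum.lessThan_Suc_shift del: sum.lessThan_Suc)
  qed
  finally show ?thesis .
qed


section \<open>Identification with the statistics of the forest\<close>

lemma sorted_labeling_eq: "sorted_labeling F w = sort_down F n w"
  unfolding sorted_labeling_def sort_result_def fold_sort_step by simp

lemma sor_B_eq: "sor_B F w = nat (total_cost F n w)"
  unfolding sor_B_def sort_result_def fold_sort_step by simp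

lemma sorting_perm_eq: "sorting_perm F w = label_perm F w (sort_down F n w)"
  by (simp add: sorting_perm_def label_perm_def sorted_labeling_eq)

lemma Cyc_B_eq:
  assumes w: "w \<in> sorted_above n"
  shows "Cyc_B F w = Cyc_upto n w"
proof -
  note nat = sort_down_natural[OF w order_refl]
  have "sort_down F n w x \<in> Cyc_B_perm n (sorting_perm F w) \<longleftrightarrow>
      sort_down F n w x \<le> int n \<and> balanced_min (sorting_perm F w) (sort_down F n w x)"
    if "x \<in> V" for x
    using Cyc_B_perm_iff[OF label_perm_permutes[OF nat w] label_perm_uminus]
      natural_range[OF nat that] by (simp add: sorting_perm_eq)
  then show ?thesis
    unfolding Cyc_B_def Cyc_upto_def sorted_labeling_eq sorting_perm_eq by blast
qed

lemma Cyc_eq: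
  assumes w: "w \<in> sorted_above n" and E: "E = {1}"
  shows "Cyc F w = Cyc_upto n w"
proof -
  note nat = sort_down_natural[OF w order_refl]
  have "sorting_perm F w permutes ({- int n..int n} - {0})"
    using label_perm_permutes[OF nat w] by (simp add: sorting_perm_eq)
  then have perm: "permutation (sorting_perm F w)"
    unfolding permutation_permutes by (intro exI[of _ "{- int n..int n} - {0}"]) simp
  have pos: "sorting_perm F w ` {1..int n} \<subseteq> {1..int n}"
  proof
    fix z assume "z \<in> sorting_perm F w ` {1..int n}"
    then obtain m where m: "m \<in> {1..int n}" "z = sorting_perm F w m" by blast
    then have "m \<in> sort_down F n w ` V" using natural_bij[OF nat] by (simp add: bij_betw_def)
    then obtain x where x: "x \<in> V" "m = sort_down F n w x" by blast
    then have "z = w x" using m label_perm_apply[OF nat] by (simp add: sorting_perm_eq)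
    moreover have "0 < w x" using sorted_above_sgn[OF w x(1)] E by (simp add: sgn_if split: if_splits)
    ultimately show "z \<in> {1..int n}" using sorted_above_range[OF w x(1)] by simp
  qed
  have "sort_down F n w x \<in> Cyc_perm n (sorting_perm F w) \<longleftrightarrow>
      sort_down F n w x \<le> int n \<and> balanced_min (sorting_perm F w) (sort_down F n w x)"
    if "x \<in> V" for x
    using Cyc_perm_iff[OF perm pos] natural_range[OF nat that] by simp
  then show ?thesis
    unfolding Cyc_def Cyc_upto_def sorted_labeling_eq sorting_perm_eq by blast
qed

lemma labelings_eq:
  assumes E: "E = {1}" shows "labelings F = sorted_above n"
proof (intro set_eqI iffI)
  fix w assume w: "w \<in> labelings F"
  then have pos: "1 \<le> w x \<and> w x \<le> int n" if "x \<in> V" for x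
    using that bij_betwE[of w V "{1..int n}"] by (force simp: labelings_def)
  have sgn: "sgn (w x) \<in> E" if "x \<in> V" for x
    using pos[OF that] by (simp add: E sgn_if)
  have "bij_betw (\<lambda>x. \<bar>w x\<bar>) V {1..int n} \<longleftrightarrow> bij_betw w V {1..int n}"
    using pos by (intro bij_betw_cong) force
  then show "w \<in> sorted_above n"
    using w pos sgn by (force simp: labelings_def sorted_above_def)
next
  fix w assume w: "w \<in> sorted_above n"
  have pos: "0 < w x" if "x \<in> V" for x
    using sorted_above_sgn[OF w that] E by (simp add: sgn_if split: if_splits)
  have "bij_betw (\<lambda>x. \<bar>w x\<bar>) V {1..int n} \<longleftrightarrow> bij_betw w V {1..int n}"
    using pos by (intro bij_betw_cong) force
  then show "w \<in> labelings F"
    using sorted_above_bij[OF w] sorted_above_ext[OF w] by (simp add: labelings_def)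
qed

lemma signed_labelings_eq:
  assumes E: "E = {1, -1}" shows "signed_labelings F = sorted_above n"
proof (intro set_eqI iffI)
  fix w assume w: "w \<in> signed_labelings F"
  have range: "w x \<in> {- int n..int n} - {0}" if "x \<in> V" for x
    using w that by (auto simp: signed_labelings_def PiE_def Pi_def)
  then have range': "w x \<noteq> 0" "\<bar>w x\<bar> \<le> int n" if "x \<in> V" for x
    using that by (fastforce simp: abs_le_iff)+
  have sgn: "sgn (w x) \<in> E" if "x \<in> V" for x
    using range'(1)[OF that] by (simp add: E sgn_if)
  have "inj_on (\<lambda>x. \<bar>w x\<bar>) V"
  proof (rule inj_onI)
    fix x y assume xy: "x \<in> V" "y \<in> V" "\<bar>w x\<bar> = \<bar>w y\<bar>"
    have "- w y \<notin> w ` V" using w xy by (simp add: signed_labelings_def)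
    then have "w x \<noteq> - w y" using xy(1) by (metis imageI)
    then have "w x = w y" using xy(3) by linarith
    then show "x = y" using w xy by (auto simp: signed_labelings_def dest: inj_onD)
  qed
  moreover have "(\<lambda>x. \<bar>w x\<bar>) ` V = {1..int n}"
  proof (rule card_subset_eq)
    show "(\<lambda>x. \<bar>w x\<bar>) ` V \<subseteq> {1..int n}" using range' by force
    show "card ((\<lambda>x. \<bar>w x\<bar>) ` V) = card {1..int n}" using calculation by (simp add: card_image)
  qed simp
  ultimately show "w \<in> sorted_above n"
    using w range' sgn by (force simp: sorted_above_def bij_betw_def signed_labelings_def PiE_def)
next
  fix w assume w: "w \<in> sorted_above n"
  have "inj_on w V"
    by (rule inj_onI) (simp add: sorted_above_inj[OF w])
  moreover have "- i \<notin> w ` V" if i: "i \<in> w ` V" for i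
  proof
    assume "- i \<in> w ` V"
    then obtain y where y: "y \<in> V" "- i = w y" by (rule imageE)
    from i obtain x where x: "x \<in> V" "i = w x" by (rule imageE)
    have "x = y" using sorted_above_inj[OF w x(1) y(1)] x(2) y(2) by simp
    then show False using x y(2) sorted_above_nonzero[OF w x(1)] by simp
  qed
  moreover have "w x \<in> {- int n..int n} - {0}" if "x \<in> V" for x
    using sorted_above_range[OF w that] by auto
  ultimately show "w \<in> signed_labelings F"
    using sorted_above_ext[OF w] by (simp add: signed_labelings_def PiE_def)
qed

end


section \<open>The number of natural labelings\<close>

context rooted_forest
begin

lemma card_labelings: "card (labelings F) = fact n"
proof -
  let ?I = "{1..int n}"
  obtain e where e: "bij_betw e V ?I"
    using finite_same_card_bij[of V ?I] by auto
  have "bij_betw (\<lambda>p. restrict (p \<circ> e) V) {p. p permutes ?I} (labelings F)"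
  proof (rule bij_betw_byWitness[where
        f' = "\<lambda>w m. if m \<in> ?I then w (inv_into V e m) else m"])
    show "\<forall>p\<in>{p. p permutes ?I}.
        (\<lambda>m. if m \<in> ?I then restrict (p \<circ> e) V (inv_into V e m) else m) = p"
    proof (intro ballI ext)
      fix p m assume "p \<in> {p. p permutes ?I}"
      then show "(if m \<in> ?I then restrict (p \<circ> e) V (inv_into V e m) else m) = p m"
        using bij_betw_inv_into_right[OF e, of m] bij_betw_apply[OF bij_betw_inv_into[OF e], of m]
        by (auto simp: permutes_not_in)
    qed
    show "\<forall>w\<in>labelings F.
        restrict ((\<lambda>m. if m \<in> ?I then w (inv_into V e m) else m) \<circ> e) V = w"
    proof (intro ballI ext)
      fix w x assume "w \<in> labelings F"
      then show "restrict ((\<lambda>m. if m \<in> ?I then w (inv_into V e m) else m) \<circ> e) V x = w x"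
        using bij_betw_inv_into_left[OF e, of x] bij_betw_apply[OF e, of x]
        by (auto simp: labelings_def extensional_def)
    qed
    show "(\<lambda>p. restrict (p \<circ> e) V) ` {p. p permutes ?I} \<subseteq> labelings F"
    proof clarify
      fix p assume "p permutes ?I"
      then have "bij_betw (p \<circ> e) V ?I"
        by (intro bij_betw_trans[OF e] permutes_imp_bij)
      then have "bij_betw (restrict (p \<circ> e) V) V ?I"
        by (simp cong: bij_betw_cong)
      then show "restrict (p \<circ> e) V \<in> labelings F" by (simp add: labelings_def)
    qed
    show "(\<lambda>w m. if m \<in> ?I then w (inv_into V e m) else m) ` labelings F \<subseteq> {p. p permutes ?I}"
    proof clarify
      fix w assume "w \<in> labelings F"
      then have "bij_betw (w \<circ> inv_into V e) ?I ?I"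
        by (intro bij_betw_trans[OF bij_betw_inv_into[OF e]]) (simp add: labelings_def)
      moreover have "bij_betw (\<lambda>m. if m \<in> ?I then w (inv_into V e m) else m) ?I ?I \<longleftrightarrow>
          bij_betw (w \<circ> inv_into V e) ?I ?I"
        by (rule bij_betw_cong) simp
      ultimately have "bij_betw (\<lambda>m. if m \<in> ?I then w (inv_into V e m) else m) ?I ?I" by simp
      then show "(\<lambda>m. if m \<in> ?I then w (inv_into V e m) else m) permutes ?I"
        by (rule bij_imp_permutes) auto
    qed
  qed
  then have "card (labelings F) = card {p. p permutes ?I}"
    by (rule bij_betw_same_card[symmetric])
  also have "\<dots> = fact n" by (rule card_permutations) simp_all
  finally show ?thesis .
qed

text \<open>Sorting distributes the \<open>n!\<close> unsigned labelings evenly over the natural ones, \<open>\<Prod> h\<^sub>v\<close> to each; this is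
  the sum of the statistics at \<open>q = t\<^sub>v = 1\<close>.\<close>

lemma hook_length_formula:
  "fact n = card natural_labelings * (\<Prod>v\<in>V. hook F v)"
proof -
  interpret signed_forest F "{1}" by unfold_locales simp
  have "(\<Sum>w\<in>sorted_above n. 1 ^ nat (total_cost F n w) * (\<Prod>v\<in>Cyc_upto n w. 1)) =
    of_nat (card natural_labelings) * (\<Prod>v\<in>V. (\<Sum>i<card {1::int} * hook F v. 1 ^ i) - 1 + (1::int))"
    by (rule sum_statistics)
  then have "int (card (labelings F)) = int (card natural_labelings * (\<Prod>v\<in>V. hook F v))"
    by (simp add: labelings_eq)
  then show ?thesis unfolding card_labelings by (metis of_nat_eq_iff)
qed

end


section \<open>The joint distribution of sorting index and cycles\<close>

theorem corollary3p4:
  fixes F :: "'v plane_forest" and n :: nat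
  assumes "rooted_plane_forest F" and "card (verts F) = n" and "n \<ge> 1"
  shows
    "(\<Sum>w\<in>labelings F. q_var ^ sor F w * (\<Prod>v\<in>Cyc F w. t_var v)) =
       const_poly (fact n / of_nat (\<Prod>v\<in>verts F. hook F v)) *
       (\<Prod>v\<in>verts F. q_int (hook F v) - 1 + t_var v)
     \<and>
     (\<Sum>w\<in>signed_labelings F. q_var ^ sor_B F w * (\<Prod>v\<in>Cyc_B F w. t_var v)) =
       const_poly (fact n / of_nat (\<Prod>v\<in>verts F. hook F v)) *
       (\<Prod>v\<in>verts F. q_int (2 * hook F v) - 1 + t_var v)"
proof -
  interpret rooted_forest F by unfold_locales (rule assms(1))
  interpret A: signed_forest F "{1}" by unfold_locales simp
  interpret B: signed_forest F "{1, -1}" by unfold_locales simp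
  have card_signs: "card {1, -1 :: int} = 2" by simp
  have hooks: "(\<Prod>v\<in>verts F. hook F v) \<noteq> 0" using hook_pos by force
  have "(fact (card (verts F)) :: rat) = of_nat (card natural_labelings * (\<Prod>v\<in>verts F. hook F v))"
    unfolding hook_length_formula[symmetric] by simp
  then have "fact (card (verts F)) / of_nat (\<Prod>v\<in>verts F. hook F v) = (of_nat (card natural_labelings) :: rat)"
    using hooks by (simp del: of_nat_prod prod_zero_iff)
  then have const: "const_poly (fact (card (verts F)) / of_nat (\<Prod>v\<in>verts F. hook F v)) =
      (of_nat (card natural_labelings) :: 'v qt_poly)"
    by (simp add: const_poly_def del: of_nat_prod)
  show ?thesis
    unfolding assms(2)[symmetric] const
  proof
    show "(\<Sum>w\<in>labelings F. q_var ^ sor F w * (\<Prod>v\<in>Cyc F w. t_var v)) =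
       of_nat (card natural_labelings) * (\<Prod>v\<in>verts F. q_int (hook F v) - 1 + t_var v)"
      using A.sum_statistics[of q_var t_var]
      by (simp add: A.labelings_eq A.Cyc_eq sor_def A.sor_B_eq q_int_def)
    show "(\<Sum>w\<in>signed_labelings F. q_var ^ sor_B F w * (\<Prod>v\<in>Cyc_B F w. t_var v)) =
       of_nat (card natural_labelings) * (\<Prod>v\<in>verts F. q_int (2 * hook F v) - 1 + t_var v)"
      using B.sum_statistics[of q_var t_var, unfolded card_signs]
      by (simp add: B.signed_labelings_eq B.Cyc_B_eq B.sor_B_eq q_int_def)
  qed
qed

end
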